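(* Let $\rho$ be a mixed state (density matrix) acting in $\mathcal{A}(\mathbb{C}^{4}\otimes\mathbb{C}^{4})$ with spectral decomposition $\rho=\sum_{i=1}^r|\Psi_i\rangle\langle\Psi_i|$, where $r$ is the rank of $\rho$ and the eigenvectors $|\Psi_i\rangle$ belonging to the nonzero eigenvalues $\lambda_i$ are normalized so that $\langle\Psi_i|\Psi_j\rangle=\lambda_i\delta_{ij}$. Let $|\Psi_i\rangle=\sum_{a,b=1}^4 w^i_{ab}f^{\dagger}_af^{\dagger}_b|\Omega\rangle$ in some single-particle orthonormal basis, with $w^i$ antisymmetric, and define the complex symmetric $r\times r$ matrix $C$ by $$C_{ij}=\sum_{a,b,c,d=1}^4\epsilon^{abcd}w^i_{ab}w^j_{cd}.$$ Represent $C$, using a unitary matrix $U$, as $C=UC_dU^T$ with $C_d=\mathrm{diag}[c_1,c_2,\ldots,c_r]$ diagonal and $|c_1|\ge|c_2|\ge\dots\ge|c_r|$. Then $\rho$ has Slater number $1$ if and only if $$|c_1|\le\sum_{i=2}^r|c_i|.$$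
   Context: $\mathcal{A}(\mathbb{C}^{4}\otimes\mathbb{C}^{4})$ is the antisymmetric subspace (two fermions with single-particle space $\mathbb{C}^4$). For an orthonormal basis $e_1,\dots,e_4$ of $\mathbb{C}^4$, $f_a^\dagger$ are the corresponding fermionic creation operators, $|\Omega\rangle$ the vacuum, and $f_a^\dagger f_b^\dagger|\Omega\rangle=\frac{1}{\sqrt2}(e_a\otimes e_b-e_b\otimes e_a)$. $\epsilon^{abcd}$ is the totally antisymmetric tensor with $\epsilon^{1234}=1$. Slater rank of a pure state: every unit vector in $\mathcal{A}(\mathbb{C}^{2K}\otimes\mathbb{C}^{2K})$ can be written as $\sum_{i=1}^{K}z_i f_{a_1(i)}^\dagger f_{a_2(i)}^\dagger|\Omega\rangle$ where the $2K$ states $f_{a_1(i)}^\dagger|\Omega\rangle, f_{a_2(i)}^\dagger|\Omega\rangle$ form an orthonormal basis of $\mathbb{C}^{2K}$; the number of nonzero $z_i$ is its Slater rank (equivalently, half the rank of its antisymmetric coefficient matrix $w$). Slater number of a density matrix $\rho$: consider all convex decompositions $\rho=\sum_i p_i|\psi_i\rangle\langle\psi_i|$ into pure states; the Slater number is the minimum over all decompositions of the maximal Slater rank of the $|\psi_i\rangle$ occurring in the decomposition. *)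

theory Defs
  imports "HOL-Analysis.Analysis" "HOL-Combinatorics.Permutations"
begin

section \<open>Hermitian inner product, states\<close>

text \<open>The library inner product on \<^typ>\<open>complex ^ 'n\<close> is the real part of the Hermitian
  one; the norms agree.\<close>

definition cinner :: "complex ^ 'n \<Rightarrow> complex ^ 'n \<Rightarrow> complex" where
  "cinner x y = (\<Sum>i\<in>UNIV. cnj (x $ i) * y $ i)"

text \<open>A family indexed by the finite type \<^typ>\<open>'n\<close> itself has as many members as the
  dimension, so orthonormality makes it a basis.\<close>

definition orthonormal_basis :: "('n \<Rightarrow> complex ^ 'n) \<Rightarrow> bool" where
  "orthonormal_basis e \<longleftrightarrow> (\<forall>a b. cinner (e a) (e b) = (if a = b then 1 else 0))"

definition ketbra :: "complex ^ 'n \<Rightarrow> complex ^ 'n ^ 'n" where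
  "ketbra \<psi> = (\<chi> i j. \<psi> $ i * cnj (\<psi> $ j))"

definition hermitian :: "complex ^ 'n ^ 'n \<Rightarrow> bool" where
  "hermitian A \<longleftrightarrow> (\<forall>i j. A $ i $ j = cnj (A $ j $ i))"

definition density_matrix :: "complex ^ 'n ^ 'n \<Rightarrow> bool" where
  "density_matrix \<rho> \<longleftrightarrow>
     hermitian \<rho> \<and> (\<forall>x. 0 \<le> Re (cinner x (\<rho> *v x))) \<and> trace \<rho> = 1"


section \<open>Two fermions\<close>

text \<open>Elements of the tensor square are coefficient vectors indexed by pairs.\<close>

definition tensor :: "complex ^ 'n \<Rightarrow> complex ^ 'n \<Rightarrow> complex ^ ('n::finite \<times> 'n)" where
  "tensor x y = (\<chi> ij. x $ fst ij * y $ snd ij)"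

definition antisym_space :: "(complex ^ ('n::finite \<times> 'n)) set" where
  "antisym_space = {\<psi>. \<forall>i j. \<psi> $ (i, j) = - \<psi> $ (j, i)}"

text \<open>The state obtained by applying the creation operators of the modes \<open>x\<close> and \<open>y\<close> to
  the vacuum.\<close>

definition fermion_pair :: "complex ^ 'n \<Rightarrow> complex ^ 'n \<Rightarrow> complex ^ ('n::finite \<times> 'n)" where
  "fermion_pair x y = complex_of_real (1 / sqrt 2) *s (tensor x y - tensor y x)"

text \<open>Since the range of a Hermitian matrix is the orthogonal complement of its kernel,
  the range condition says that \<open>\<rho>\<close> is an operator on the antisymmetric subspace,
  extended by zero.\<close>

definition fermionic_density_matrix :: "complex ^ ('n::finite \<times> 'n) ^ ('n \<times> 'n) \<Rightarrow> bool" where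
  "fermionic_density_matrix \<rho> \<longleftrightarrow>
     density_matrix \<rho> \<and> (\<forall>x. \<rho> *v x \<in> antisym_space)"


section \<open>Slater rank and Slater number\<close>

text \<open>With \<open>CARD('n) = 2 * K\<close>, the index maps \<open>a1\<close> and \<open>a2\<close> split the index set of the
  orthonormal basis \<open>f\<close> into \<open>K\<close> pairs.\<close>

definition slater_decomposition ::
  "complex ^ ('n::finite \<times> 'n) \<Rightarrow> ('n \<Rightarrow> complex ^ 'n) \<Rightarrow> (nat \<Rightarrow> 'n) \<Rightarrow> (nat \<Rightarrow> 'n) \<Rightarrow> (nat \<Rightarrow> complex) \<Rightarrow> bool"
where
  "slater_decomposition \<psi> f a1 a2 z \<longleftrightarrow>
     (let K = CARD('n) div 2 in
        orthonormal_basis f \<and>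
        inj_on a1 {1..K} \<and> inj_on a2 {1..K} \<and>
        a1 ` {1..K} \<inter> a2 ` {1..K} = {} \<and> a1 ` {1..K} \<union> a2 ` {1..K} = UNIV \<and>
        \<psi> = (\<Sum>i=1..K. z i *s fermion_pair (f (a1 i)) (f (a2 i))))"

text \<open>The decomposition of \<open>\<psi>\<close> is not unique, but the number of nonzero coefficients is:
  it is half the rank of the coefficient matrix.\<close>

definition slater_rank :: "complex ^ ('n::finite \<times> 'n) \<Rightarrow> nat" where
  "slater_rank \<psi> =
     (THE k. \<exists>f a1 a2 z. slater_decomposition \<psi> f a1 a2 z \<and>
        k = card {i \<in> {1..CARD('n) div 2}. z i \<noteq> 0})"

text \<open>Only the states occurring in the decomposition are listed, hence the weights are
  strictly positive.\<close>

definition pure_decomposition ::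
  "complex ^ ('n::finite \<times> 'n) ^ ('n \<times> 'n) \<Rightarrow> nat \<Rightarrow> (nat \<Rightarrow> real) \<Rightarrow> (nat \<Rightarrow> complex ^ ('n \<times> 'n)) \<Rightarrow> bool"
where
  "pure_decomposition \<rho> N p \<psi> \<longleftrightarrow>
     (\<forall>i\<in>{1..N}. 0 < p i \<and> \<psi> i \<in> antisym_space \<and> norm (\<psi> i) = 1) \<and>
     (\<Sum>i=1..N. p i) = 1 \<and>
     \<rho> = (\<Sum>i=1..N. p i *\<^sub>R ketbra (\<psi> i))"

definition slater_number :: "complex ^ ('n::finite \<times> 'n) ^ ('n \<times> 'n) \<Rightarrow> nat" where
  "slater_number \<rho> =
     (LEAST k. \<exists>N p \<psi>. pure_decomposition \<rho> N p \<psi> \<and> k = Max ((\<lambda>i. slater_rank (\<psi> i)) ` {1..N}))"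


section \<open>The totally antisymmetric tensor\<close>

text \<open>In the four-element type \<^typ>\<open>4\<close> the numerals \<open>1, 2, 3, 4\<close> denote the distinct
  elements (with \<open>4 = 0\<close>), so the usual labels can be used literally.\<close>

definition levi_civita :: "4 \<Rightarrow> 4 \<Rightarrow> 4 \<Rightarrow> 4 \<Rightarrow> complex" where
  "levi_civita a b c d =
     (let \<pi> = id(1 := a, 2 := b, 3 := c, 4 := d)
      in if bij \<pi> then of_int (sign \<pi>) else 0)"

lemma levi_civita_1234: "levi_civita 1 2 3 4 = 1"
proof -
  have "id(1 := 1, 2 := 2, 3 := 3, 4 := 4) = (id :: 4 \<Rightarrow> 4)"
    by (simp add: fun_eq_iff)
  then show ?thesis
    by (simp add: levi_civita_def)
qed

lemma levi_civita_swap_aux: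
  fixes \<pi> :: "4 \<Rightarrow> 4"
  assumes "x \<noteq> y"
  shows "(if bij (\<pi> \<circ> Transposition.transpose x y) then of_int (sign (\<pi> \<circ> Transposition.transpose x y)) else 0 :: complex) =
    - (if bij \<pi> then of_int (sign \<pi>) else 0)"
proof -
  have "bij (\<pi> \<circ> Transposition.transpose x y) \<longleftrightarrow> bij \<pi>"
    by (metis bij_betw_comp_iff bij_transpose)
  moreover have "sign (\<pi> \<circ> Transposition.transpose x y) = - sign \<pi>" if "bij \<pi>"
  proof -
    have "permutation \<pi>"
      using that by (simp add: permutation)
    then show ?thesis
      using assms by (simp add: sign_compose permutation_swap_id sign_swap_id)
  qed
  ultimately show ?thesis by simp
qed

lemma levi_civita_swap:
  "levi_civita b a c d = - levi_civita a b c d"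
  "levi_civita a c b d = - levi_civita a b c d"
  "levi_civita a b d c = - levi_civita a b c d"
proof -
  let ?p = "id(1 := a, 2 := b, 3 := c, 4 := d) :: 4 \<Rightarrow> 4"
  have *: "id(1 := b, 2 := a, 3 := c, 4 := d) = ?p \<circ> Transposition.transpose 1 2"
    "id(1 := a, 2 := c, 3 := b, 4 := d) = ?p \<circ> Transposition.transpose 2 3"
    "id(1 := a, 2 := b, 3 := d, 4 := c) = ?p \<circ> Transposition.transpose 3 4"
    by (auto simp: fun_eq_iff Transposition.transpose_def)
  show "levi_civita b a c d = - levi_civita a b c d"
    "levi_civita a c b d = - levi_civita a b c d"
    "levi_civita a b d c = - levi_civita a b c d"
    unfolding levi_civita_def Let_def * by (rule levi_civita_swap_aux; simp)+
qed


section \<open>Matrices of size \<open>r\<close>\<close>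

text \<open>The size is a natural number, so these are functions, used on \<open>{1..r}\<close> only.\<close>

definition unitary_matrix :: "nat \<Rightarrow> (nat \<Rightarrow> nat \<Rightarrow> complex) \<Rightarrow> bool" where
  "unitary_matrix r U \<longleftrightarrow>
     (\<forall>i\<in>{1..r}. \<forall>j\<in>{1..r}. (\<Sum>k=1..r. U i k * cnj (U j k)) = (if i = j then 1 else 0))"

definition diag_matrix :: "(nat \<Rightarrow> complex) \<Rightarrow> nat \<Rightarrow> nat \<Rightarrow> complex" where
  "diag_matrix c i j = (if i = j then c i else 0)"

text \<open>The matrix \<open>C\<close> built from the coefficient matrices \<open>w i\<close>.\<close>

definition correlation_matrix :: "(nat \<Rightarrow> complex ^ 4 ^ 4) \<Rightarrow> nat \<Rightarrow> nat \<Rightarrow> complex" where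
  "correlation_matrix w i j =
     (\<Sum>a\<in>UNIV. \<Sum>b\<in>UNIV. \<Sum>c\<in>UNIV. \<Sum>d\<in>UNIV.
        levi_civita a b c d * w i $ a $ b * w j $ c $ d)"

end

theory Submission
  imports Defs
begin

text \<open>On antisymmetric vectors of \<open>\<complex>\<^sup>4 \<otimes> \<complex>\<^sup>4\<close> the quadratic form \<open>\<psi> \<mapsto> \<epsilon>\<^sup>a\<^sup>b\<^sup>c\<^sup>d \<psi>\<^sub>a\<^sub>b \<psi>\<^sub>c\<^sub>d\<close>
  equals \<open>4 z\<^sub>1 z\<^sub>2 det f\<close> in terms of a Slater decomposition, so it vanishes exactly on the vectors of
  Slater rank at most \<open>1\<close>, and the question is whether \<open>\<rho>\<close> is a mixture of isotropic vectors. Every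
  ensemble for \<open>\<rho>\<close> arises from the \<open>\<Psi>\<^sub>i\<close> by an isometry, and after the change of basis \<open>U\<close> isotropy of its
  \<open>k\<close>-th member reads \<open>\<Sum>\<^sub>l c\<^sub>l V\<^sub>k\<^sub>l\<^sup>2 = 0\<close> with \<open>V\<close> an isometry. The triangle inequality, summed over \<open>k\<close>,
  gives the necessity of the condition. Conversely, the condition says that segments of lengths
  \<open>\<bar>c\<^sub>l\<bar>\<close> close up to a polygon, i.e. \<open>\<Sum>\<^sub>l c\<^sub>l \<omega>\<^sub>l\<^sup>2 = 0\<close> for some phases \<open>\<omega>\<^sub>l\<close>; then all vectors of
  coefficients \<open>\<plusminus>\<omega>\<^sub>l\<close>, over all choices of signs, form an isotropic ensemble for \<open>\<rho>\<close>.\<close>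

section \<open>Hermitian products and determinants\<close>

lemma cinner_commute: "cinner y x = cnj (cinner x y)"
  by (simp add: cinner_def mult.commute)

lemma cinner_zero_commute: "cinner x y = 0 \<Longrightarrow> cinner y x = 0"
  by (simp add: cinner_commute[of y x])

lemma cinner_add_right: "cinner x (y + z) = cinner x y + cinner x z"
  and cinner_diff_right: "cinner x (y - z) = cinner x y - cinner x z"
  and cinner_minus_right: "cinner x (- y) = - cinner x y"
  and cinner_scale_right: "cinner x (k *s y) = k * cinner x y"
  and cinner_zero_right: "cinner x 0 = 0"
  by (simp_all add: cinner_def algebra_simps sum.distrib sum_subtractf sum_negf sum_distrib_left)

lemma cinner_add_left: "cinner (y + z) x = cinner y x + cinner z x"
  and cinner_diff_left: "cinner (y - z) x = cinner y x - cinner z x"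
  and cinner_minus_left: "cinner (- y) x = - cinner y x"
  and cinner_scale_left: "cinner (k *s y) x = cnj k * cinner y x"
  and cinner_zero_left: "cinner 0 x = 0"
  by (simp_all add: cinner_def algebra_simps sum.distrib sum_subtractf sum_negf sum_distrib_left)

lemma cinner_sum_right: "cinner x (\<Sum>i\<in>I. f i) = (\<Sum>i\<in>I. cinner x (f i))"
  by (simp add: cinner_def sum_distrib_left) (rule sum.swap)

lemma cinner_sum_left: "cinner (\<Sum>i\<in>I. f i) x = (\<Sum>i\<in>I. cinner (f i) x)"
  by (simp add: cinner_def sum_distrib_right) (rule sum.swap)

lemmas cinner_simps =
  cinner_add_right cinner_diff_right cinner_minus_right cinner_scale_right cinner_zero_right
  cinner_add_left cinner_diff_left cinner_minus_left cinner_scale_left cinner_zero_left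

lemma Re_cinner: "Re (cinner x y) = x \<bullet> y"
  by (simp add: cinner_def inner_vec_def inner_complex_def)

lemma cinner_self: "cinner x x = complex_of_real ((norm x)\<^sup>2)"
proof -
  have "cnj (cinner x x) = cinner x x"
    by (rule cinner_commute[symmetric])
  then have "Im (cinner x x) = 0"
    by (simp add: complex_eq_iff)
  then show ?thesis
    by (simp add: complex_eq_iff Re_cinner power2_norm_eq_inner)
qed

lemma cinner_self_eq_0_iff: "cinner x x = 0 \<longleftrightarrow> x = 0"
  by (simp add: cinner_self)

lemma norm_scale_complex: "norm (k *s (x :: complex ^ 'n)) = cmod k * norm x"
proof -
  have "cinner (k *s x) (k *s x) = (k * cnj k) * cinner x x"
    by (simp add: cinner_simps)
  also have "k * cnj k = complex_of_real ((cmod k)\<^sup>2)"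
    by (rule complex_norm_square[symmetric])
  finally have "complex_of_real ((norm (k *s x))\<^sup>2) = complex_of_real ((cmod k * norm x)\<^sup>2)"
    unfolding cinner_self by (simp add: power_mult_distrib)
  then show ?thesis
    using of_real_eq_iff power2_eq_iff_nonneg by (metis mult_nonneg_nonneg norm_ge_zero)
qed

text \<open>Orthonormality is the first equation. The second, which expresses completeness, follows
  because a right inverse of a square matrix is also a left inverse.\<close>

lemma matrix_rows_of_basis:
  assumes "orthonormal_basis (f :: 'n::finite \<Rightarrow> complex ^ 'n)"
  shows "(\<chi> i j. f i $ j) ** (\<chi> i j. cnj (f j $ i)) = mat 1"
    and "(\<chi> i j. cnj (f j $ i)) ** (\<chi> i j. f i $ j) = mat 1"
proof -
  show "(\<chi> i j. f i $ j) ** (\<chi> i j. cnj (f j $ i)) = mat 1"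
    using assms
    by (auto simp: matrix_matrix_mult_def vec_eq_iff mat_def orthonormal_basis_def cinner_def mult.commute)
  then show "(\<chi> i j. cnj (f j $ i)) ** (\<chi> i j. f i $ j) = mat 1"
    by (simp add: matrix_left_right_inverse)
qed

lemma orthonormal_basis_complete:
  assumes "orthonormal_basis (f :: 'n::finite \<Rightarrow> complex ^ 'n)"
  shows "(\<Sum>a\<in>UNIV. f a $ i * cnj (f a $ j)) = (if i = j then 1 else 0)"
proof -
  have "(\<Sum>a\<in>UNIV. cnj (f a $ j) * f a $ i) = (if j = i then 1 else 0)"
    using matrix_rows_of_basis(2)[OF assms]
    by (simp add: matrix_matrix_mult_def vec_eq_iff mat_def)
  then show ?thesis
    by (simp add: mult.commute eq_commute)
qed

lemma orthonormal_basis_det_nz: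
  assumes "orthonormal_basis (f :: 'n::finite \<Rightarrow> complex ^ 'n)"
  shows "det (\<chi> i. f i) \<noteq> 0"
proof -
  have "(\<chi> i. f i) = (\<chi> i j. f i $ j)"
    by (simp add: vec_eq_iff)
  then have "det (\<chi> i. f i) * det (\<chi> i j. cnj (f j $ i)) = 1"
    using arg_cong[OF matrix_rows_of_basis(1)[OF assms], of det] by (simp add: det_mul)
  then show ?thesis
    by auto
qed

text \<open>Real orthogonality to both \<open>s\<close> and \<open>\<i> *s s\<close> amounts to
  Hermitian orthogonality to \<open>s\<close>. The set \<open>?T\<close> has at most
  \<open>2 * card S\<close> elements, fewer than the real dimension
  \<open>2 * CARD('n)\<close>.\<close>

lemma exists_unit_orthogonal:
  fixes S :: "(complex ^ 'n) set"
  assumes "finite S" "card S < CARD('n)"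
  obtains u where "norm u = 1" "\<And>s. s \<in> S \<Longrightarrow> cinner s u = 0"
proof -
  let ?T = "S \<union> ((*s) \<i>) ` S"
  have "dim ?T \<le> card ?T"
    using assms by (intro dim_le_card') auto
  also have "\<dots> \<le> card S + card (((*s) \<i>) ` S)"
    by (rule card_Un_le)
  also have "\<dots> \<le> card S + card S"
    using assms card_image_le by (intro add_left_mono) blast
  also have "\<dots> < DIM(complex ^ 'n)"
    using assms by simp
  finally obtain x where x: "x \<noteq> 0" "\<And>y. y \<in> span ?T \<Longrightarrow> orthogonal x y"
    using orthogonal_to_subspace_exists by blast
  have *: "cinner s x = 0" if "s \<in> S" for s
  proof -
    have "s \<in> span ?T" "\<i> *s s \<in> span ?T"
      using that by (auto intro: span_base)
    then have "Re (cinner s x) = 0" "Re (cinner (\<i> *s s) x) = 0"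
      using x(2)[of s] x(2)[of "\<i> *s s"] unfolding Re_cinner orthogonal_def by (simp_all add: inner_commute)
    then show ?thesis
      by (simp add: cinner_scale_left complex_eq_iff)
  qed
  show ?thesis
  proof
    show "norm (complex_of_real (1 / norm x) *s x) = 1"
      using x(1) by (simp add: norm_scale_complex norm_divide)
    show "cinner s (complex_of_real (1 / norm x) *s x) = 0" if "s \<in> S" for s
      using *[OF that] by (simp add: cinner_simps)
  qed
qed

section \<open>The determinant as a contraction with the Levi-Civita tensor\<close>

definition alternating_form :: "complex ^ 4 \<Rightarrow> complex ^ 4 \<Rightarrow> complex ^ 4 \<Rightarrow> complex ^ 4 \<Rightarrow> complex" where
  "alternating_form x y u v =
     (\<Sum>a\<in>UNIV. \<Sum>b\<in>UNIV. \<Sum>c\<in>UNIV. \<Sum>d\<in>UNIV. levi_civita a b c d * (x $ a * y $ b * u $ c * v $ d))"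

text \<open>Quadruples of indices correspond to self-maps of the index type. The Levi-Civita symbol
  vanishes on the non-bijective ones, and what remains is the Leibniz sum over permutations.\<close>

lemma alternating_form_eq_det: "alternating_form (g 1) (g 2) (g 3) (g 4) = det (\<chi> i. g i)"
proof -
  define h where "h = (\<lambda>\<pi> :: 4 \<Rightarrow> 4. if bij \<pi> then of_int (sign \<pi>) * (\<Prod>i\<in>UNIV. g i $ \<pi> i) else 0)"
  define q where "q = (\<lambda>(a, b, c, d). id(1 := a, 2 := b, 3 := c, 4 := d) :: 4 \<Rightarrow> 4)"
  have q: "bij q"
  proof (rule o_bij)
    show "(\<lambda>\<pi>. (\<pi> 1, \<pi> 2, \<pi> 3, \<pi> 4)) \<circ> q = id"
      by (auto simp: fun_eq_iff q_def)
    show "q \<circ> (\<lambda>\<pi>. (\<pi> 1, \<pi> 2, \<pi> 3, \<pi> 4)) = id"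
      by (auto simp: fun_eq_iff q_def forall_4)
  qed
  have prod4: "prod f UNIV = f 1 * f 2 * f 3 * f 4" for f :: "4 \<Rightarrow> complex"
    unfolding UNIV_4 by (simp add: ac_simps)
  have "alternating_form (g 1) (g 2) (g 3) (g 4) = (\<Sum>t\<in>UNIV. h (q t))"
    unfolding alternating_form_def sum.cartesian_product UNIV_Times_UNIV
    by (rule sum.cong) (auto simp: q_def h_def levi_civita_def prod4 Let_def)
  also have "\<dots> = sum h UNIV"
    using sum.reindex_bij_betw[OF q] .
  also have "\<dots> = sum h {\<pi>. \<pi> permutes UNIV}"
    by (rule sum.mono_neutral_right) (auto simp: h_def intro: bij_imp_permutes)
  also have "\<dots> = det (\<chi> i. g i)"
    unfolding det_def by (rule sum.cong) (auto simp: h_def permutes_bij)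
  finally show ?thesis .
qed

text \<open>Permuting rows multiplies the determinant by the sign, and a repeated row makes it zero.
  A change of single-particle basis therefore costs only the factor
  \<open>det (\<chi> i. e i)\<close>.\<close>

lemma alternating_form_basis:
  "alternating_form (e a) (e b) (e c) (e d) = levi_civita a b c d * det (\<chi> i. e i)"
proof -
  define \<pi> where "\<pi> = (id(1 := a, 2 := b, 3 := c, 4 := d) :: 4 \<Rightarrow> 4)"
  have *: "alternating_form (e a) (e b) (e c) (e d) = det (\<chi> i. e (\<pi> i))"
    using alternating_form_eq_det[of "\<lambda>i. e (\<pi> i)"] by (simp add: \<pi>_def)
  show ?thesis
  proof (cases "bij \<pi>")
    case True
    then have "\<pi> permutes UNIV"
      by (intro bij_imp_permutes) auto
    then show ?thesis
      using True det_permute_rows[of \<pi> "\<chi> i. e i"] unfolding *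
      by (simp add: levi_civita_def \<pi>_def[symmetric])
  next
    case False
    then have "\<not> inj \<pi>"
      using finite_UNIV_inj_surj[of \<pi>] by (auto simp: bij_def)
    then obtain i j where "i \<noteq> j" "\<pi> i = \<pi> j"
      by (auto simp: inj_def)
    then have "det (\<chi> i. e (\<pi> i)) = 0"
      by (intro det_identical_rows[of i j]) (auto simp: row_def)
    then show ?thesis
      using False unfolding * by (simp add: levi_civita_def \<pi>_def[symmetric])
  qed
qed

section \<open>Slater decompositions and the Pfaffian form\<close>

lemma orthonormal_basis_expansion:
  assumes "orthonormal_basis (f :: 'n::finite \<Rightarrow> complex ^ 'n)"
  shows "x = (\<Sum>a\<in>UNIV. cinner (f a) x *s f a)"
proof -
  have "(\<Sum>a\<in>UNIV. cinner (f a) x *s f a) $ i = x $ i" for i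
  proof -
    have "(\<Sum>a\<in>UNIV. cinner (f a) x *s f a) $ i = (\<Sum>a\<in>UNIV. \<Sum>j\<in>UNIV. (f a $ i * cnj (f a $ j)) * x $ j)"
      by (simp add: cinner_def sum_distrib_right sum_distrib_left mult_ac)
    also have "\<dots> = (\<Sum>j\<in>UNIV. (\<Sum>a\<in>UNIV. f a $ i * cnj (f a $ j)) * x $ j)"
      unfolding sum_distrib_right by (rule sum.swap)
    also have "\<dots> = x $ i"
      by (simp add: orthonormal_basis_complete[OF assms] if_distrib[of "\<lambda>y. y * _"] cong: if_cong)
    finally show ?thesis .
  qed
  then show ?thesis
    by (simp add: vec_eq_iff)
qed

text \<open>The conjugation makes \<open>cinner v (antilinear_map \<psi> u)\<close> equal to
  \<open>cinner (tensor u v) \<psi>\<close>, so that antisymmetry of \<psi> becomes skewness of the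
  map.\<close>

definition antilinear_map :: "complex ^ ('n::finite \<times> 'n) \<Rightarrow> complex ^ 'n \<Rightarrow> complex ^ 'n" where
  "antilinear_map \<psi> u = (\<chi> j. \<Sum>i\<in>UNIV. cnj (u $ i) * \<psi> $ (i, j))"

lemma antilinear_map_skew:
  assumes "\<psi> \<in> antisym_space"
  shows "cinner v (antilinear_map \<psi> u) = - cinner u (antilinear_map \<psi> v)"
proof -
  have \<psi>: "\<psi> $ (i, j) = - \<psi> $ (j, i)" for i j
    using assms unfolding antisym_space_def by blast
  have "cinner v (antilinear_map \<psi> u) = (\<Sum>j\<in>UNIV. \<Sum>i\<in>UNIV. cnj (v $ j) * cnj (u $ i) * \<psi> $ (i, j))"
    by (simp add: cinner_def antilinear_map_def sum_distrib_left mult_ac)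
  also have "\<dots> = (\<Sum>i\<in>UNIV. \<Sum>j\<in>UNIV. cnj (v $ j) * cnj (u $ i) * \<psi> $ (i, j))"
    by (rule sum.swap)
  also have "\<dots> = (\<Sum>i\<in>UNIV. \<Sum>j\<in>UNIV. - (cnj (u $ i) * (cnj (v $ j) * \<psi> $ (j, i))))"
  proof (intro sum.cong refl)
    show "cnj (v $ j) * cnj (u $ i) * \<psi> $ (i, j) = - (cnj (u $ i) * (cnj (v $ j) * \<psi> $ (j, i)))" for i j
      using \<psi>[of i j] by simp
  qed
  also have "\<dots> = - cinner u (antilinear_map \<psi> v)"
    by (simp add: cinner_def antilinear_map_def sum_distrib_left sum_negf)
  finally show ?thesis .
qed

text \<open>The completeness relation of \<open>f\<close> is inserted in the first tensor
  factor.\<close>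

lemma antilinear_map_expansion:
  assumes "orthonormal_basis (f :: 'n::finite \<Rightarrow> complex ^ 'n)"
  shows "\<psi> = (\<Sum>a\<in>UNIV. tensor (f a) (antilinear_map \<psi> (f a)))"
proof -
  have "(\<Sum>a\<in>UNIV. tensor (f a) (antilinear_map \<psi> (f a))) $ (i, j) = \<psi> $ (i, j)" for i j
  proof -
    have "(\<Sum>a\<in>UNIV. tensor (f a) (antilinear_map \<psi> (f a))) $ (i, j) =
        (\<Sum>a\<in>UNIV. \<Sum>k\<in>UNIV. (f a $ i * cnj (f a $ k)) * \<psi> $ (k, j))"
      by (simp add: tensor_def antilinear_map_def sum_distrib_left mult.assoc)
    also have "\<dots> = (\<Sum>k\<in>UNIV. (\<Sum>a\<in>UNIV. f a $ i * cnj (f a $ k)) * \<psi> $ (k, j))"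
      unfolding sum_distrib_right by (rule sum.swap)
    also have "\<dots> = \<psi> $ (i, j)"
      by (simp add: orthonormal_basis_complete[OF assms] if_distrib[of "\<lambda>y. y * _"] cong: if_cong)
    finally show ?thesis .
  qed
  then show ?thesis
    by (simp add: vec_eq_iff)
qed

text \<open>With \<open>T = antilinear_map \<psi>\<close>, take a unit vector \<open>x\<close> maximising \<open>norm (T x) = s\<close> and put
  \<open>y = T x / s\<close>. Skewness gives \<open>cinner x y = 0\<close> and \<open>cinner x (T y) = - s\<close>, and maximality then
  forces \<open>T y = - s x\<close>, so that \<open>T\<close> also preserves the orthogonal complement of \<open>x\<close> and \<open>y\<close>.\<close>

lemma exists_slater_pair:
  fixes \<psi> :: "complex ^ ('n::finite \<times> 'n)"
  assumes "\<psi> \<in> antisym_space" "\<psi> \<noteq> 0"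
  obtains x y s where "norm x = 1" "norm y = 1" "cinner x y = 0"
    "antilinear_map \<psi> x = complex_of_real s *s y" "antilinear_map \<psi> y = - complex_of_real s *s x"
proof -
  define T where "T = antilinear_map \<psi>"
  have "continuous_on (sphere 0 1) (\<lambda>x. norm (T x))"
    unfolding T_def antilinear_map_def by (intro continuous_intros)
  moreover have "sphere 0 1 \<noteq> ({} :: (complex ^ 'n) set)"
    by simp
  ultimately obtain x where x: "x \<in> sphere 0 1" "\<And>y. y \<in> sphere 0 1 \<Longrightarrow> norm (T y) \<le> norm (T x)"
    using continuous_attains_sup[OF compact_sphere, of 0 1 "\<lambda>x. norm (T x)"] by blast
  have nx: "norm x = 1"
    using x(1) by simp
  define s where "s = norm (T x)"
  have "s \<noteq> 0"
  proof
    assume "s = 0"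
    have "\<psi> $ (i, j) = 0" for i j
    proof -
      have "norm (axis i (1 :: complex)) = 1"
        by (simp add: norm_eq_1 inner_axis_axis)
      then have "T (axis i 1) = 0"
        using x(2)[of "axis i 1"] \<open>s = 0\<close> by (simp add: s_def)
      moreover have "T (axis i 1) $ j = \<psi> $ (i, j)"
        by (simp add: T_def antilinear_map_def axis_def if_distrib[of cnj] if_distrib[of "\<lambda>y. y * _"] cong: if_cong)
      ultimately show ?thesis
        by simp
    qed
    then show False
      using assms(2) by (simp add: vec_eq_iff)
  qed
  define y where "y = complex_of_real (1 / s) *s T x"
  have Tx: "T x = complex_of_real s *s y"
    using \<open>s \<noteq> 0\<close> by (simp add: y_def)
  have ny: "norm y = 1"
    using \<open>s \<noteq> 0\<close> by (simp add: y_def norm_scale_complex norm_divide s_def)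
  have "cinner x (T x) = 0"
    using antilinear_map_skew[OF assms(1), of x x] by (simp add: T_def)
  then have xy: "cinner x y = 0"
    by (simp add: y_def cinner_simps)
  have "cinner x (T y) = - cinner y (T x)"
    unfolding T_def by (rule antilinear_map_skew[OF assms(1)])
  also have "\<dots> = - complex_of_real s"
    by (simp add: Tx cinner_simps cinner_self ny)
  finally have xTy: "x \<bullet> T y = - s"
    by (simp flip: Re_cinner)
  have "norm (T y) \<le> s"
    using x(2)[of y] ny by (simp add: s_def)
  then have "(norm (T y))\<^sup>2 \<le> s\<^sup>2"
    by (intro power_mono) auto
  \<comment> \<open>With \<open>x \<bullet> T y = - s\<close> and \<open>norm x = 1\<close> the
    right side is \<open>(norm (T y))\<^sup>2 - s\<^sup>2\<close>, which maximality makes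
    nonpositive: the equality case of Cauchy-Schwarz.\<close>
  moreover have "(norm (T y + s *\<^sub>R x))\<^sup>2 = (norm (T y))\<^sup>2 + 2 * s * (x \<bullet> T y) + s\<^sup>2 * (norm x)\<^sup>2"
    unfolding power2_norm_eq_inner by (simp add: inner_add_left inner_add_right inner_commute power2_eq_square algebra_simps)
  ultimately have "(norm (T y + s *\<^sub>R x))\<^sup>2 \<le> 0"
    by (simp add: xTy nx power2_eq_square)
  then have "T y = - (s *\<^sub>R x)"
    by (simp add: eq_neg_iff_add_eq_0)
  also have "\<dots> = - complex_of_real s *s x"
    unfolding vec_eq_iff by (simp add: scaleR_conv_of_real[where 'a = complex])
  finally show ?thesis
    using that[of x y s] nx ny xy Tx by (simp add: T_def)
qed

text \<open>Once the pair \<open>x\<close>, \<open>y\<close> is split off, a plane remains, on which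
  a skew map is given by a single number \<open>c\<close>. Any orthonormal \<open>u\<close>,
  \<open>v\<close> in that plane therefore form the second pair.\<close>

lemma slater_decomposition_exists:
  assumes "\<psi> \<in> antisym_space" "(\<psi> :: complex ^ (4 \<times> 4)) \<noteq> 0"
  obtains f a1 a2 z where "slater_decomposition \<psi> f a1 a2 z"
proof -
  define T where "T = antilinear_map \<psi>"
  have skew: "cinner v (T u) = - cinner u (T v)" for u v
    unfolding T_def by (rule antilinear_map_skew[OF assms(1)])
  obtain x y s where xy: "norm x = 1" "norm y = 1" "cinner x y = 0"
    and Tx: "T x = complex_of_real s *s y" and Ty: "T y = - complex_of_real s *s x"
    unfolding T_def using exists_slater_pair[OF assms] .
  have "card {x, y} < CARD(4)"
    using card_insert_le_m1[of 2 "{y}" x] by simp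
  then obtain u where u: "norm u = 1" "cinner x u = 0" "cinner y u = 0"
    using exists_unit_orthogonal[of "{x, y}"] by (metis finite.emptyI finite_insert insertCI)
  have "card {x, y, u} < CARD(4)"
    using card_insert_le_m1[of 2 "{u}" y] card_insert_le_m1[of 3 "{y, u}" x] by simp
  then obtain v where v: "norm v = 1" "cinner x v = 0" "cinner y v = 0" "cinner u v = 0"
    using exists_unit_orthogonal[of "{x, y, u}"] by (metis finite.emptyI finite_insert insertCI)
  note sym = xy(3)[THEN cinner_zero_commute] u(2,3)[THEN cinner_zero_commute] v(2-4)[THEN cinner_zero_commute]
  define f :: "4 \<Rightarrow> complex ^ 4" where "f = (\<lambda>_. 0)(1 := x, 2 := y, 3 := u, 4 := v)"
  have f: "f 1 = x" "f 2 = y" "f 3 = u" "f 4 = v"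
    by (simp_all add: f_def)
  have ob: "orthonormal_basis f"
    unfolding orthonormal_basis_def forall_4 f by (simp add: xy u v sym cinner_self)
  define c where "c = cinner v (T u)"
  have exp: "t = cinner x t *s x + cinner y t *s y + cinner u t *s u + cinner v t *s v" for t
    using orthonormal_basis_expansion[OF ob, of t] by (simp add: sum_4 f)
  have "cinner u (T u) = 0" "cinner v (T v) = 0"
    using skew[of u u] skew[of v v] by auto
  \<comment> \<open>Skewness moves \<open>T\<close> onto \<open>x\<close> or \<open>y\<close>, whose
    images are multiples of \<open>y\<close> and \<open>x\<close>, both orthogonal to
    \<open>u\<close> and \<open>v\<close>.\<close>
  moreover have "cinner x (T u) = 0" "cinner x (T v) = 0" "cinner y (T u) = 0" "cinner y (T v) = 0"
    using skew[of x u] skew[of x v] skew[of y u] skew[of y v] by (auto simp: Tx Ty cinner_simps sym)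
  moreover have "cinner u (T v) = - c"
    using skew[of u v] by (simp add: c_def)
  ultimately have Tuv: "T u = c *s v" "T v = - c *s u"
    using exp[of "T u"] exp[of "T v"] by (simp_all add: c_def)
  have "\<psi> = tensor x (T x) + tensor y (T y) + tensor u (T u) + tensor v (T v)"
    using antilinear_map_expansion[OF ob, of \<psi>] by (simp add: sum_4 f T_def)
  \<comment> \<open>The factors \<open>sqrt 2\<close> cancel the normalization inside
    \<open>fermion_pair\<close>.\<close>
  also have "\<dots> = (complex_of_real (sqrt 2) * complex_of_real s) *s fermion_pair x y + (complex_of_real (sqrt 2) * c) *s fermion_pair u v"
    unfolding Tx Ty Tuv vec_eq_iff by (simp add: tensor_def fermion_pair_def algebra_simps)
  finally have \<psi>: "\<psi> = \<dots>" .
  let ?a1 = "\<lambda>i::nat. if i = 1 then 1 else 3 :: 4" and ?a2 = "\<lambda>i::nat. if i = 1 then 2 else 4 :: 4"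
    and ?z = "\<lambda>i::nat. if i = 1 then complex_of_real (sqrt 2) * complex_of_real s else complex_of_real (sqrt 2) * c"
  have I: "{1..CARD(4) div 2} = {1, 2 :: nat}"
    by auto
  have "slater_decomposition \<psi> f ?a1 ?a2 ?z"
    unfolding slater_decomposition_def Let_def I using ob UNIV_4
    by (auto simp: f \<psi>)
  then show ?thesis
    using that by blast
qed

text \<open>For antisymmetric \<psi> the value at (\<psi>, \<psi>) is 8 times the Pfaffian of the
  coefficient matrix. The polarized form is bilinear, without conjugation, so its values on pairs of
  vectors determine it on their span.\<close>

definition pfaffian_form :: "complex ^ (4 \<times> 4) \<Rightarrow> complex ^ (4 \<times> 4) \<Rightarrow> complex" where
  "pfaffian_form \<psi> \<phi> =
     (\<Sum>a\<in>UNIV. \<Sum>b\<in>UNIV. \<Sum>c\<in>UNIV. \<Sum>d\<in>UNIV. levi_civita a b c d * (\<psi> $ (a, b) * \<phi> $ (c, d)))"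

lemma pfaffian_form_simps:
  "pfaffian_form (\<psi> + \<psi>') \<phi> = pfaffian_form \<psi> \<phi> + pfaffian_form \<psi>' \<phi>"
  "pfaffian_form \<psi> (\<phi> + \<phi>') = pfaffian_form \<psi> \<phi> + pfaffian_form \<psi> \<phi>'"
  "pfaffian_form (\<psi> - \<psi>') \<phi> = pfaffian_form \<psi> \<phi> - pfaffian_form \<psi>' \<phi>"
  "pfaffian_form \<psi> (\<phi> - \<phi>') = pfaffian_form \<psi> \<phi> - pfaffian_form \<psi> \<phi>'"
  "pfaffian_form (k *s \<psi>) \<phi> = k * pfaffian_form \<psi> \<phi>"
  "pfaffian_form \<psi> (k *s \<phi>) = k * pfaffian_form \<psi> \<phi>"
  "pfaffian_form 0 \<phi> = 0"
  "pfaffian_form \<psi> 0 = 0"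
  by (simp_all add: pfaffian_form_def algebra_simps sum.distrib sum_subtractf sum_distrib_left)

lemma pfaffian_form_sum_left: "pfaffian_form (\<Sum>i\<in>I. f i) \<phi> = (\<Sum>i\<in>I. pfaffian_form (f i) \<phi>)"
  by (induction I rule: infinite_finite_induct) (simp_all add: pfaffian_form_simps)

lemma pfaffian_form_sum_right: "pfaffian_form \<psi> (\<Sum>i\<in>I. f i) = (\<Sum>i\<in>I. pfaffian_form \<psi> (f i))"
  by (induction I rule: infinite_finite_induct) (simp_all add: pfaffian_form_simps)

lemma pfaffian_form_tensor: "pfaffian_form (tensor x y) (tensor u v) = alternating_form x y u v"
  by (simp add: pfaffian_form_def alternating_form_def tensor_def mult.assoc)

lemma alternating_form_swap:
  "alternating_form y x u v = - alternating_form x y u v"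
  "alternating_form x u y v = - alternating_form x y u v"
  "alternating_form x y v u = - alternating_form x y u v"
proof -
  have "alternating_form y x u v =
      (\<Sum>b\<in>UNIV. \<Sum>a\<in>UNIV. \<Sum>c\<in>UNIV. \<Sum>d\<in>UNIV. levi_civita a b c d * (y $ a * x $ b * u $ c * v $ d))"
    unfolding alternating_form_def by (rule sum.swap)
  also have "\<dots> = - alternating_form x y u v"
    unfolding alternating_form_def sum_negf[symmetric]
    by (intro sum.cong refl, subst levi_civita_swap(1)) (simp add: mult_ac)
  finally show "alternating_form y x u v = - alternating_form x y u v" .
  have "alternating_form x u y v =
      (\<Sum>a\<in>UNIV. \<Sum>c\<in>UNIV. \<Sum>b\<in>UNIV. \<Sum>d\<in>UNIV. levi_civita a b c d * (x $ a * u $ b * y $ c * v $ d))"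
    unfolding alternating_form_def by (intro sum.cong refl sum.swap)
  also have "\<dots> = - alternating_form x y u v"
    unfolding alternating_form_def sum_negf[symmetric]
    by (intro sum.cong refl, subst levi_civita_swap(2)) (simp add: mult_ac)
  finally show "alternating_form x u y v = - alternating_form x y u v" .
  have "alternating_form x y v u =
      (\<Sum>a\<in>UNIV. \<Sum>b\<in>UNIV. \<Sum>d\<in>UNIV. \<Sum>c\<in>UNIV. levi_civita a b c d * (x $ a * y $ b * v $ c * u $ d))"
    unfolding alternating_form_def by (intro sum.cong refl sum.swap)
  also have "\<dots> = - alternating_form x y u v"
    unfolding alternating_form_def sum_negf[symmetric]
    by (intro sum.cong refl, subst levi_civita_swap(3)) (simp add: mult_ac)
  finally show "alternating_form x y v u = - alternating_form x y u v" .
qed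

text \<open>Expanding both differences gives four terms, equal by antisymmetry, against two factors
  \<open>1 / sqrt 2\<close>.\<close>

lemma pfaffian_form_fermion_pair:
  "pfaffian_form (fermion_pair x y) (fermion_pair u v) = 2 * alternating_form x y u v"
proof -
  have "pfaffian_form (fermion_pair x y) (fermion_pair u v) =
      complex_of_real (1 / sqrt 2) * (complex_of_real (1 / sqrt 2) * (4 * alternating_form x y u v))"
    unfolding fermion_pair_def pfaffian_form_simps pfaffian_form_tensor
    by (simp only: alternating_form_swap(1)[of y x] alternating_form_swap(3)[of _ _ v u]) simp
  also have "\<dots> = complex_of_real (1 / sqrt 2 * (1 / sqrt 2)) * (4 * alternating_form x y u v)"
    by (simp only: of_real_mult mult.assoc)
  also have "1 / sqrt 2 * (1 / sqrt 2) = (1 / 2 :: real)"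
    by simp
  finally show ?thesis
    by simp
qed

text \<open>Each pair is isotropic by itself, so only the cross terms survive, and they add up to a
  nonzero multiple of \<open>z 1 * z 2\<close>. Not both coefficients vanish, as \<psi> is nonzero.
  The count is thus the same for every decomposition, which justifies the \<open>THE\<close> in
  \<open>slater_rank\<close>.\<close>

lemma slater_rank_eq:
  assumes "\<psi> \<in> antisym_space" "\<psi> \<noteq> 0"
  shows "slater_rank \<psi> = (if pfaffian_form \<psi> \<psi> = 0 then 1 else 2)"
proof -
  have I: "{1..CARD(4) div 2} = {1, 2 :: nat}"
    by auto
  have *: "card {i \<in> {1, 2 :: nat}. z i \<noteq> 0} = (if pfaffian_form \<psi> \<psi> = 0 then 1 else 2)"
    if d: "slater_decomposition \<psi> f a1 a2 z" for f a1 a2 and z :: "nat \<Rightarrow> complex"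
  proof -
    \<comment> \<open>\<open>g\<close> lists the basis \<open>f\<close> with the two members of each
      pair in consecutive positions.\<close>
    define g :: "4 \<Rightarrow> complex ^ 4" where "g = (\<lambda>_. 0)(1 := f (a1 1), 2 := f (a2 1), 3 := f (a1 2), 4 := f (a2 2))"
    have g: "g 1 = f (a1 1)" "g 2 = f (a2 1)" "g 3 = f (a1 2)" "g (4 :: 4) = f (a2 2)"
      by (simp_all add: g_def)
    have f: "orthonormal_basis f" and dist: "a1 1 \<noteq> a1 2" "a2 1 \<noteq> a2 2" "a1 1 \<noteq> a2 1" "a1 1 \<noteq> a2 2" "a1 2 \<noteq> a2 1" "a1 2 \<noteq> a2 2"
      and \<psi>: "\<psi> = z 1 *s fermion_pair (g 1) (g 2) + z 2 *s fermion_pair (g 3) (g 4)"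
      using d unfolding slater_decomposition_def Let_def I g by auto
    have "cinner (f a) (f b) = (if a = b then 1 else 0)" for a b
      using f by (simp add: orthonormal_basis_def)
    then have "orthonormal_basis g"
      unfolding orthonormal_basis_def forall_4 g using dist dist[symmetric] by simp
    then have det: "alternating_form (g 1) (g 2) (g 3) (g 4) \<noteq> 0"
      unfolding alternating_form_eq_det by (rule orthonormal_basis_det_nz)
    have same: "alternating_form x y x y = 0" for x y
      using alternating_form_swap(2)[of x x y y] alternating_form_swap(1)[of x x y y] by simp
    \<comment> \<open>Exchanging two pairs takes four adjacent swaps, an even number, so the two
      cross terms agree.\<close>
    have "alternating_form u v x y = alternating_form x y u v" for x y u v
      using alternating_form_swap(2)[of u v x y] alternating_form_swap(1)[of u x v y]
        alternating_form_swap(3)[of x u v y] alternating_form_swap(2)[of x u y v] by simp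
    then have "pfaffian_form \<psi> \<psi> = 4 * z 1 * z 2 * alternating_form (g 1) (g 2) (g 3) (g 4)"
      by (simp add: \<psi> pfaffian_form_simps pfaffian_form_fermion_pair same)
    then have "pfaffian_form \<psi> \<psi> = 0 \<longleftrightarrow> z 1 = 0 \<or> z 2 = 0"
      using det by simp
    moreover have "z 1 \<noteq> 0 \<or> z 2 \<noteq> 0"
      using assms(2) by (auto simp: \<psi>)
    moreover have "{i \<in> {1, 2 :: nat}. z i \<noteq> 0} = (if z 1 = 0 then {} else {1}) \<union> (if z 2 = 0 then {} else {2})"
      by auto
    ultimately show ?thesis
      by auto
  qed
  show ?thesis
    unfolding slater_rank_def I
  proof (rule the_equality)
    show "\<exists>f a1 a2 z. slater_decomposition \<psi> f a1 a2 z \<and>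
        (if pfaffian_form \<psi> \<psi> = 0 then 1 else 2) = card {i \<in> {1, 2}. z i \<noteq> 0}"
      using slater_decomposition_exists[OF assms] * by metis
  qed (use * in metis)
qed

text \<open>The form uses standard coordinates while \<open>w\<close> refers to \<open>e\<close>.
  The change of basis enters only through the determinant, so \<open>correlation_matrix w\<close> is
  the Gram matrix of the form up to a constant.\<close>

lemma pfaffian_form_expansion:
  assumes "\<psi> = (\<Sum>a\<in>UNIV. \<Sum>b\<in>UNIV. w i $ a $ b *s fermion_pair (e a) (e b))"
    and "\<phi> = (\<Sum>a\<in>UNIV. \<Sum>b\<in>UNIV. w j $ a $ b *s fermion_pair (e a) (e b))"
  shows "pfaffian_form \<psi> \<phi> = 2 * det (\<chi> a. e a) * correlation_matrix w i j"
  unfolding assms pfaffian_form_sum_left pfaffian_form_simps(5)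
  unfolding pfaffian_form_sum_right pfaffian_form_simps(6)
    pfaffian_form_fermion_pair alternating_form_basis correlation_matrix_def sum_distrib_left
  by (intro sum.cong refl) (simp add: mult_ac)

section \<open>Ensembles of pure states\<close>

lemma pfaffian_form_sums:
  "pfaffian_form (\<Sum>i\<in>I. a i *s x i) (\<Sum>j\<in>J. b j *s y j) =
     (\<Sum>i\<in>I. \<Sum>j\<in>J. a i * b j * pfaffian_form (x i) (y j))"
  unfolding pfaffian_form_sum_left pfaffian_form_simps(5)
  unfolding pfaffian_form_sum_right pfaffian_form_simps(6) sum_distrib_left mult.assoc ..

text \<open>The squared norms become the weights, and the trace makes them add up to 1. Zero vectors
  are dropped, because weights must be positive. Each new state is a multiple of some
  \<open>\<phi> k\<close>, so isotropy is inherited.\<close>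

lemma pure_decomposition_of_ensemble:
  fixes \<phi> :: "'k \<Rightarrow> complex ^ ('n::finite \<times> 'n)"
  assumes "finite I" and \<rho>: "\<rho> = (\<Sum>k\<in>I. ketbra (\<phi> k))" and "trace \<rho> = 1"
    and antisym: "\<And>k. k \<in> I \<Longrightarrow> \<phi> k \<in> antisym_space"
  obtains N p \<psi> where "pure_decomposition \<rho> N p \<psi>"
    "\<And>i. i \<in> {1..N} \<Longrightarrow> \<exists>k\<in>I. \<exists>t. \<psi> i = t *s \<phi> k"
proof -
  define J where "J = {k \<in> I. \<phi> k \<noteq> 0}"
  have "finite J"
    using \<open>finite I\<close> by (simp add: J_def)
  then obtain h where h: "bij_betw h {1..card J} J"
    using ex_bij_betw_nat_finite_1 by blast
  then have hJ: "h i \<in> I" "\<phi> (h i) \<noteq> 0" if "i \<in> {1..card J}" for i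
    using bij_betwE[OF h] that by (auto simp: J_def)
  define p where "p i = (norm (\<phi> (h i)))\<^sup>2" for i
  define \<psi> where "\<psi> i = complex_of_real (1 / norm (\<phi> (h i))) *s \<phi> (h i)" for i
  have trace_sum: "trace (\<Sum>k\<in>A. f k) = (\<Sum>k\<in>A. trace (f k))" for A and f :: "'k \<Rightarrow> complex ^ ('n \<times> 'n) ^ ('n \<times> 'n)"
    unfolding trace_def by (simp add: sum.swap[of _ A])
  have trace_ketbra: "trace (ketbra x) = complex_of_real ((norm x)\<^sup>2)" for x :: "complex ^ ('n \<times> 'n)"
    unfolding cinner_self[symmetric] by (simp add: trace_def ketbra_def cinner_def mult.commute)
  have "ketbra (0 :: complex ^ ('n \<times> 'n)) = 0"
    by (simp add: ketbra_def vec_eq_iff)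
  then have \<rho>J: "\<rho> = (\<Sum>k\<in>J. ketbra (\<phi> k))"
    unfolding \<rho> J_def using \<open>finite I\<close> by (intro sum.mono_neutral_right) auto
  have "pure_decomposition \<rho> (card J) p \<psi>"
    unfolding pure_decomposition_def
  proof (intro conjI ballI)
    fix i assume i: "i \<in> {1..card J}"
    show "0 < p i"
      using hJ[OF i] by (simp add: p_def)
    have "\<phi> (h i) $ (a, b) = - \<phi> (h i) $ (b, a)" for a b
      using antisym[OF hJ(1)[OF i]] unfolding antisym_space_def by blast
    then have "\<psi> i $ (a, b) = - \<psi> i $ (b, a)" for a b
      unfolding \<psi>_def by (metis mult_minus_right vector_smult_component)
    then show "\<psi> i \<in> antisym_space"
      unfolding antisym_space_def by blast
    show "norm (\<psi> i) = 1"
      using hJ[OF i] by (simp add: \<psi>_def norm_scale_complex norm_divide)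
  next
    have "complex_of_real (\<Sum>i=1..card J. p i) = (\<Sum>i=1..card J. trace (ketbra (\<phi> (h i))))"
      by (simp add: p_def trace_ketbra)
    also have "\<dots> = (\<Sum>k\<in>J. trace (ketbra (\<phi> k)))"
      by (rule sum.reindex_bij_betw[OF h])
    also have "\<dots> = complex_of_real 1"
      using assms(3) by (simp add: \<rho>J trace_sum)
    finally show "(\<Sum>i=1..card J. p i) = 1"
      unfolding of_real_eq_iff .
  next
    have "p i *\<^sub>R ketbra (\<psi> i) = ketbra (\<phi> (h i))" if "i \<in> {1..card J}" for i
    proof -
      have "p i *\<^sub>R (\<psi> i $ a * cnj (\<psi> i $ b)) = \<phi> (h i) $ a * cnj (\<phi> (h i) $ b)" for a b
        using hJ(2)[OF that] by (simp add: p_def \<psi>_def scaleR_conv_of_real field_simps power2_eq_square)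
      then show ?thesis
        by (simp add: ketbra_def vec_eq_iff)
    qed
    then have "(\<Sum>i=1..card J. p i *\<^sub>R ketbra (\<psi> i)) = (\<Sum>i=1..card J. ketbra (\<phi> (h i)))"
      by simp
    also have "\<dots> = \<rho>"
      unfolding \<rho>J by (rule sum.reindex_bij_betw[OF h])
    finally show "\<rho> = (\<Sum>i=1..card J. p i *\<^sub>R ketbra (\<psi> i))" ..
  qed
  then show ?thesis
    using that hJ(1) unfolding \<psi>_def by blast
qed

text \<open>Unit vectors here have Slater rank 1 or 2, so 1 is the least conceivable maximum. The
  given decomposition guarantees that the \<open>LEAST\<close> is attained.\<close>

lemma slater_number_eq_1_iff:
  assumes "pure_decomposition \<rho> N0 p0 \<psi>0"
  shows "slater_number \<rho> = 1 \<longleftrightarrow>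
    (\<exists>N p \<psi>. pure_decomposition \<rho> N p \<psi> \<and> (\<forall>i\<in>{1..N}. pfaffian_form (\<psi> i) (\<psi> i) = 0))"
proof -
  define P where "P k \<longleftrightarrow>
    (\<exists>N p \<psi>. pure_decomposition \<rho> N p \<psi> \<and> k = Max ((\<lambda>i. slater_rank (\<psi> i)) ` {1..N}))" for k
  have sn: "slater_number \<rho> = (LEAST k. P k)"
    by (simp add: slater_number_def P_def)
  have Max1: "1 \<le> Max ((\<lambda>i. slater_rank (\<psi> i)) ` {1..N}) \<and>
      (Max ((\<lambda>i. slater_rank (\<psi> i)) ` {1..N}) = 1 \<longleftrightarrow> (\<forall>i\<in>{1..N}. pfaffian_form (\<psi> i) (\<psi> i) = 0))"
    if d: "pure_decomposition \<rho> N p \<psi>" for N p \<psi>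
  proof -
    let ?R = "(\<lambda>i. slater_rank (\<psi> i)) ` {1..N}"
    have "slater_rank (\<psi> i) = (if pfaffian_form (\<psi> i) (\<psi> i) = 0 then 1 else 2)" if "i \<in> {1..N}" for i
    proof -
      have "\<psi> i \<in> antisym_space" "norm (\<psi> i) = 1"
        using d that by (auto simp: pure_decomposition_def)
      then show ?thesis
        by (intro slater_rank_eq) auto
    qed
    note rk = this
    have "sum p {1..N} = 1"
      using d by (simp add: pure_decomposition_def)
    \<comment> \<open>The weights add up to 1, so \<open>Max\<close> is not taken over the empty
      set.\<close>
    then have "N \<noteq> 0"
      by (intro notI) simp
    then have ne: "?R \<noteq> {}"
      by simp
    have "1 \<in> {1..N}"
      using \<open>N \<noteq> 0\<close> by simp
    then have "slater_rank (\<psi> 1) \<le> Max ?R"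
      by (intro Max_ge) auto
    then have ge: "1 \<le> Max ?R"
      using rk[OF \<open>1 \<in> {1..N}\<close>] by (simp split: if_splits)
    have "Max ?R \<le> 1 \<longleftrightarrow> (\<forall>i\<in>{1..N}. slater_rank (\<psi> i) \<le> 1)"
      using ne by (subst Max_le_iff) auto
    also have "\<dots> \<longleftrightarrow> (\<forall>i\<in>{1..N}. pfaffian_form (\<psi> i) (\<psi> i) = 0)"
      using rk by (intro ball_cong) auto
    finally show ?thesis
      using ge by auto
  qed
  have "\<exists>k. P k"
    using assms unfolding P_def by blast
  then have "P (slater_number \<rho>)"
    unfolding sn by (rule LeastI_ex)
  then have "slater_number \<rho> = 1 \<Longrightarrow> P 1"
    by simp
  moreover have "slater_number \<rho> = 1" if "P 1"
    unfolding sn using that by (rule Least_equality) (use Max1 P_def in auto)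
  moreover have "P 1 \<longleftrightarrow>
      (\<exists>N p \<psi>. pure_decomposition \<rho> N p \<psi> \<and> (\<forall>i\<in>{1..N}. pfaffian_form (\<psi> i) (\<psi> i) = 0))"
    unfolding P_def using Max1 by metis
  ultimately show ?thesis
    by blast
qed

text \<open>For \<open>P = U\<^sup>* U\<close>, the matrix \<open>1 - P\<close> is an orthogonal projection of trace \<open>0\<close>, hence zero.\<close>

lemma unitary_matrix_columns:
  assumes "unitary_matrix r U" "l \<in> {1..r}" "m \<in> {1..r}"
  shows "(\<Sum>i=1..r. cnj (U i l) * U i m) = (if l = m then 1 else 0)"
proof -
  have U: "(\<Sum>k=1..r. U i k * cnj (U j k)) = (if i = j then 1 else 0)" if "i \<in> {1..r}" "j \<in> {1..r}" for i j
    using assms(1) that by (simp add: unitary_matrix_def)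
  define P where "P l m = (\<Sum>i=1..r. cnj (U i l) * U i m)" for l m
  have cnjP: "cnj (P l m) = P m l" for l m
    by (simp add: P_def mult.commute)
  have PP: "(\<Sum>j=1..r. P l j * P j m) = P l m" for l m
  proof -
    have "(\<Sum>j=1..r. P l j * P j m) =
        (\<Sum>j=1..r. \<Sum>i=1..r. \<Sum>k=1..r. cnj (U i l) * U k m * (U i j * cnj (U k j)))"
      unfolding P_def sum_product by (intro sum.cong refl) (simp add: mult_ac)
    also have "\<dots> = (\<Sum>i=1..r. \<Sum>j=1..r. \<Sum>k=1..r. cnj (U i l) * U k m * (U i j * cnj (U k j)))"
      by (rule sum.swap)
    also have "\<dots> = (\<Sum>i=1..r. \<Sum>k=1..r. \<Sum>j=1..r. cnj (U i l) * U k m * (U i j * cnj (U k j)))"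
      by (intro sum.cong refl sum.swap)
    also have "\<dots> = (\<Sum>i=1..r. \<Sum>k=1..r. cnj (U i l) * U k m * (if i = k then 1 else 0))"
      unfolding sum_distrib_left[symmetric] by (intro sum.cong refl) (simp only: U)
    also have "\<dots> = P l m"
      unfolding P_def by (intro sum.cong refl) (simp add: if_distrib[of "(*) _"] cong: if_cong)
    finally show ?thesis .
  qed
  define D where "D l m = (if l = m then 1 else 0) - P l m" for l m
  \<comment> \<open>The squared Frobenius norm of \<open>D\<close> is computed: since
    \<open>P\<close> is Hermitian and idempotent, it equals \<open>r\<close> minus the trace of
    \<open>P\<close>.\<close>
  have "(\<Sum>l=1..r. \<Sum>m=1..r. complex_of_real ((cmod (D l m))\<^sup>2)) =
      (\<Sum>l=1..r. \<Sum>m=1..r. (if l = m then 1 - P l l - P l l else 0) + P l m * P m l)"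
  proof (intro sum.cong refl)
    fix l m
    have "complex_of_real ((cmod (D l m))\<^sup>2) = D l m * cnj (D l m)"
      by (rule complex_norm_square)
    also have "cnj (D l m) = (if l = m then 1 else 0) - P m l"
      by (simp add: D_def cnjP)
    finally have D: "complex_of_real ((cmod (D l m))\<^sup>2) = D l m * ((if l = m then 1 else 0) - P m l)" .
    show "complex_of_real ((cmod (D l m))\<^sup>2) = (if l = m then 1 - P l l - P l l else 0) + P l m * P m l"
      unfolding D unfolding D_def by (simp add: algebra_simps)
  qed
  also have "\<dots> = (\<Sum>l=1..r. 1 - P l l)"
    by (intro sum.cong refl) (simp add: sum.distrib PP del: One_nat_def)
  also have "\<dots> = of_nat r - (\<Sum>l=1..r. \<Sum>i=1..r. U i l * cnj (U i l))"
    by (simp add: sum_subtractf P_def mult.commute)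
  \<comment> \<open>Summed in the other order, the trace of \<open>P\<close> is the sum of the
    squared row norms of \<open>U\<close>, all equal to 1.\<close>
  also have "(\<Sum>l=1..r. \<Sum>i=1..r. U i l * cnj (U i l)) = (\<Sum>i=1..r. \<Sum>l=1..r. U i l * cnj (U i l))"
    by (rule sum.swap)
  also have "\<dots> = of_nat r"
    by (simp add: U del: One_nat_def)
  finally have "complex_of_real (\<Sum>l=1..r. \<Sum>m=1..r. (cmod (D l m))\<^sup>2) = 0"
    by simp
  then have "(\<Sum>l=1..r. \<Sum>m=1..r. (cmod (D l m))\<^sup>2) = 0"
    by (simp only: of_real_eq_0_iff)
  then have "(\<Sum>m=1..r. (cmod (D l m))\<^sup>2) = 0"
    using assms(2) by (subst (asm) sum_nonneg_eq_0_iff) (auto intro: sum_nonneg)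
  then have "D l m = 0"
    using assms(3) by (subst (asm) sum_nonneg_eq_0_iff) auto
  then show ?thesis
    by (simp add: D_def P_def)
qed

section \<open>Ensembles representing the same density matrix\<close>

lemma ketbra_sum_mult: "(\<Sum>k\<in>I. ketbra (\<phi> k)) *v x = (\<Sum>k\<in>I. cinner (\<phi> k) x *s \<phi> k)"
proof -
  have "((\<Sum>k\<in>I. ketbra (\<phi> k)) *v x) $ i = (\<Sum>k\<in>I. cinner (\<phi> k) x *s \<phi> k) $ i" for i
  proof -
    have "((\<Sum>k\<in>I. ketbra (\<phi> k)) *v x) $ i = (\<Sum>j\<in>UNIV. \<Sum>k\<in>I. \<phi> k $ i * cnj (\<phi> k $ j) * x $ j)"
      by (simp add: matrix_vector_mult_def ketbra_def sum_distrib_right)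
    also have "\<dots> = (\<Sum>k\<in>I. \<Sum>j\<in>UNIV. \<phi> k $ i * cnj (\<phi> k $ j) * x $ j)"
      by (rule sum.swap)
    also have "\<dots> = (\<Sum>k\<in>I. cinner (\<phi> k) x *s \<phi> k) $ i"
      unfolding sum_component vector_smult_component cinner_def sum_distrib_right
      by (intro sum.cong refl) (simp add: mult_ac)
    finally show ?thesis .
  qed
  then show ?thesis
    by (simp add: vec_eq_iff)
qed

text \<open>The easy half of the Schroedinger-HJW theorem: the columns of \<open>A\<close> are
  orthonormal, so all cross terms cancel in the sum over \<open>K\<close>.\<close>

lemma ketbra_isometric_mixture:
  assumes "finite L" and iso: "\<And>l m. l \<in> L \<Longrightarrow> m \<in> L \<Longrightarrow> (\<Sum>k\<in>K. A k l * cnj (A k m)) = (if l = m then 1 else 0)"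
  shows "(\<Sum>k\<in>K. ketbra (\<Sum>l\<in>L. A k l *s \<Phi> l)) = (\<Sum>l\<in>L. ketbra (\<Phi> l))"
proof -
  have "(\<Sum>k\<in>K. ketbra (\<Sum>l\<in>L. A k l *s \<Phi> l)) $ i $ j = (\<Sum>l\<in>L. ketbra (\<Phi> l)) $ i $ j" for i j
  proof -
    have "(\<Sum>k\<in>K. ketbra (\<Sum>l\<in>L. A k l *s \<Phi> l)) $ i $ j =
        (\<Sum>k\<in>K. \<Sum>l\<in>L. \<Sum>m\<in>L. \<Phi> l $ i * cnj (\<Phi> m $ j) * (A k l * cnj (A k m)))"
      by (simp add: ketbra_def sum_product mult_ac)
    also have "\<dots> = (\<Sum>l\<in>L. \<Sum>k\<in>K. \<Sum>m\<in>L. \<Phi> l $ i * cnj (\<Phi> m $ j) * (A k l * cnj (A k m)))"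
      by (rule sum.swap)
    also have "\<dots> = (\<Sum>l\<in>L. \<Sum>m\<in>L. \<Sum>k\<in>K. \<Phi> l $ i * cnj (\<Phi> m $ j) * (A k l * cnj (A k m)))"
      by (intro sum.cong refl sum.swap)
    also have "\<dots> = (\<Sum>l\<in>L. \<Sum>m\<in>L. \<Phi> l $ i * cnj (\<Phi> m $ j) * (if l = m then 1 else 0))"
      unfolding sum_distrib_left[symmetric] by (intro sum.cong refl) (simp only: iso)
    also have "\<dots> = (\<Sum>l\<in>L. ketbra (\<Phi> l)) $ i $ j"
      using \<open>finite L\<close> by (simp add: ketbra_def if_distrib[of "(*) _"] cong: if_cong)
    finally show ?thesis .
  qed
  then show ?thesis
    by (simp add: vec_eq_iff)
qed

text \<open>The converse half, relative to an orthogonal ensemble: \<open>T\<close> consists of the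
  coefficients of the projections of \<open>\<phi> k\<close> onto the \<open>\<Psi> l\<close>. It
  remains to see that \<open>\<phi> k\<close> lies in their span.\<close>

lemma ensembles_isometric:
  assumes "finite L" and eq: "(\<Sum>k\<in>K. ketbra (\<phi> k)) = (\<Sum>l\<in>L. ketbra (\<Psi> l))" and "finite K"
    and orth: "\<And>l m. l \<in> L \<Longrightarrow> m \<in> L \<Longrightarrow> cinner (\<Psi> l) (\<Psi> m) = (if l = m then complex_of_real (ev l) else 0)"
    and ev: "\<And>l. l \<in> L \<Longrightarrow> ev l \<noteq> 0"
  obtains T where "\<And>k. k \<in> K \<Longrightarrow> \<phi> k = (\<Sum>l\<in>L. T k l *s \<Psi> l)"
    "\<And>l m. l \<in> L \<Longrightarrow> m \<in> L \<Longrightarrow> (\<Sum>k\<in>K. T k l * cnj (T k m)) = (if l = m then 1 else 0)"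
proof
  define T where "T k l = cinner (\<Psi> l) (\<phi> k) / complex_of_real (ev l)" for k l
  have eq': "(\<Sum>k\<in>K. cinner (\<phi> k) x *s \<phi> k) = (\<Sum>l\<in>L. cinner (\<Psi> l) x *s \<Psi> l)" for x
    unfolding ketbra_sum_mult[symmetric] eq ..
  show "\<phi> k = (\<Sum>l\<in>L. T k l *s \<Psi> l)" if "k \<in> K" for k
  proof -
    define x where "x = \<phi> k - (\<Sum>l\<in>L. T k l *s \<Psi> l)"
    have x\<Psi>: "cinner (\<Psi> m) x = 0" if "m \<in> L" for m
    proof -
      have "cinner (\<Psi> m) (\<Sum>l\<in>L. T k l *s \<Psi> l) = (\<Sum>l\<in>L. if l = m then T k m * ev m else 0)"
        unfolding cinner_sum_right cinner_scale_right using that by (intro sum.cong refl) (simp add: orth)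
      also have "\<dots> = cinner (\<Psi> m) (\<phi> k)"
        using that \<open>finite L\<close> ev[of m] by (simp add: T_def)
      finally show ?thesis
        by (simp add: x_def cinner_diff_right)
    qed
    \<comment> \<open>The expectation value of the common operator at \<open>x\<close> is a sum of
      squares in terms of \<phi> and zero in terms of \<Psi>, so \<open>x\<close> is orthogonal to
      \<open>\<phi> k\<close> as well, hence to itself.\<close>
    have "cinner x (\<Sum>k\<in>K. cinner (\<phi> k) x *s \<phi> k) = (\<Sum>k\<in>K. cinner (\<phi> k) x * cnj (cinner (\<phi> k) x))"
      unfolding cinner_sum_right cinner_scale_right cinner_commute[of x] ..
    also have "\<dots> = complex_of_real (\<Sum>k\<in>K. (cmod (cinner (\<phi> k) x))\<^sup>2)"
      by (simp only: of_real_sum complex_norm_square)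
    finally have "complex_of_real (\<Sum>k\<in>K. (cmod (cinner (\<phi> k) x))\<^sup>2) = 0"
      unfolding eq' by (simp add: x\<Psi> cinner_zero_right)
    then have "(\<Sum>k\<in>K. (cmod (cinner (\<phi> k) x))\<^sup>2) = 0"
      by (simp only: of_real_eq_0_iff)
    then have "cinner (\<phi> k) x = 0"
      using that \<open>finite K\<close> by (subst (asm) sum_nonneg_eq_0_iff) auto
    moreover have "cinner x x = cinner (\<phi> k) x - (\<Sum>l\<in>L. cnj (T k l) * cinner (\<Psi> l) x)"
      by (subst (1) x_def) (simp add: cinner_diff_left cinner_sum_left cinner_scale_left)
    ultimately have "x = 0"
      by (simp add: x\<Psi> cinner_self_eq_0_iff[symmetric])
    then show ?thesis
      by (simp add: x_def)
  qed
  show "(\<Sum>k\<in>K. T k l * cnj (T k m)) = (if l = m then 1 else 0)" if "l \<in> L" "m \<in> L" for l m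
  proof -
    \<comment> \<open>Up to the eigenvalues this is a matrix element of the operator between
      \<open>\<Psi> l\<close> and \<open>\<Psi> m\<close>, which is then evaluated with the other
      ensemble.\<close>
    have "(\<Sum>k\<in>K. T k l * cnj (T k m)) =
        (\<Sum>k\<in>K. cinner (\<phi> k) (\<Psi> m) * cinner (\<Psi> l) (\<phi> k)) / (complex_of_real (ev l) * complex_of_real (ev m))"
      by (simp add: T_def sum_divide_distrib cinner_commute[of "\<Psi> m"] mult_ac)
    also have "(\<Sum>k\<in>K. cinner (\<phi> k) (\<Psi> m) * cinner (\<Psi> l) (\<phi> k)) = cinner (\<Psi> l) (\<Sum>k\<in>K. cinner (\<phi> k) (\<Psi> m) *s \<phi> k)"
      by (simp add: cinner_sum_right cinner_scale_right)
    also have "\<dots> = (\<Sum>i\<in>L. cinner (\<Psi> i) (\<Psi> m) * cinner (\<Psi> l) (\<Psi> i))"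
      by (simp add: eq' cinner_sum_right cinner_scale_right)
    also have "\<dots> = (\<Sum>i\<in>L. if i = l then (if l = m then complex_of_real (ev l) * complex_of_real (ev l) else 0) else 0)"
      using that by (intro sum.cong refl) (simp add: orth)
    finally show ?thesis
      using that \<open>finite L\<close> ev[of l] by auto
  qed
qed

section \<open>Closing polygons with phases and signs\<close>

text \<open>For each \<open>k\<close> the first term is minus the sum of the others. When the
  triangle inequalities are added over \<open>k\<close>, the weights
  \<open>(cmod (V k l))\<^sup>2\<close> add up to 1 for every \<open>l\<close>.\<close>

lemma polygon_inequality_of_isotropic_vectors:
  fixes c :: "nat \<Rightarrow> complex"
  assumes "1 \<le> r"
    and isotropic: "\<And>k. k \<in> K \<Longrightarrow> (\<Sum>l=1..r. c l * (V k l)\<^sup>2) = 0"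
    and normalized: "\<And>l. l \<in> {1..r} \<Longrightarrow> (\<Sum>k\<in>K. (cmod (V k l))\<^sup>2) = 1"
  shows "cmod (c 1) \<le> (\<Sum>l=2..r. cmod (c l))"
proof -
  have *: "cmod (c 1) * (cmod (V k 1))\<^sup>2 \<le> (\<Sum>l=2..r. cmod (c l) * (cmod (V k l))\<^sup>2)" if "k \<in> K" for k
  proof -
    have "c 1 * (V k 1)\<^sup>2 = - (\<Sum>l=2..r. c l * (V k l)\<^sup>2)"
      using isotropic[OF that] \<open>1 \<le> r\<close>
      by (simp add: sum.atLeast_Suc_atMost eq_neg_iff_add_eq_0 numeral_2_eq_2)
    then have "cmod (c 1 * (V k 1)\<^sup>2) = cmod (\<Sum>l=2..r. c l * (V k l)\<^sup>2)"
      by simp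
    also have "\<dots> \<le> (\<Sum>l=2..r. cmod (c l * (V k l)\<^sup>2))"
      by (rule norm_sum)
    finally show ?thesis
      by (simp add: norm_mult norm_power)
  qed
  have "cmod (c 1) = (\<Sum>k\<in>K. cmod (c 1) * (cmod (V k 1))\<^sup>2)"
    using normalized[of 1] \<open>1 \<le> r\<close> by (simp flip: sum_distrib_left)
  also have "\<dots> \<le> (\<Sum>k\<in>K. \<Sum>l=2..r. cmod (c l) * (cmod (V k l))\<^sup>2)"
    by (rule sum_mono) (rule *)
  also have "\<dots> = (\<Sum>l=2..r. \<Sum>k\<in>K. cmod (c l) * (cmod (V k l))\<^sup>2)"
    by (rule sum.swap)
  also have "\<dots> = (\<Sum>l=2..r. cmod (c l))"
    using normalized by (intro sum.cong refl) (simp flip: sum_distrib_left)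
  finally show ?thesis .
qed

text \<open>Greedy choice of signs: a new term of size at most \<open>M\<close>, taken with the sign
  opposite to the current sum, keeps the sum within \<open>M\<close>.\<close>

lemma exists_small_signed_sum:
  fixes a :: "'i \<Rightarrow> real"
  assumes "finite I" "\<And>i. i \<in> I \<Longrightarrow> 0 \<le> a i \<and> a i \<le> M" "0 \<le> M"
  shows "\<exists>S. \<bar>\<Sum>i\<in>I. if i \<in> S then - a i else a i\<bar> \<le> M"
  using assms
proof (induction I rule: finite_induct)
  case (insert j I)
  then obtain S where S: "\<bar>\<Sum>i\<in>I. if i \<in> S then - a i else a i\<bar> \<le> M"
    by auto
  define x where "x = (\<Sum>i\<in>I. if i \<in> S then - a i else a i)"
  have aj: "0 \<le> a j" "a j \<le> M"
    using insert.prems by auto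
  \<comment> \<open>As \<open>j\<close> is not in \<open>I\<close>, its membership in
    \<open>S\<close> can be chosen freely without changing the earlier signs.\<close>
  have "(\<Sum>i\<in>I. if i \<in> insert j S then - a i else a i) = x"
    "(\<Sum>i\<in>I. if i \<in> S - {j} then - a i else a i) = x"
    unfolding x_def using insert.hyps by (auto intro!: sum.cong)
  then have "(\<Sum>i\<in>insert j I. if i \<in> insert j S then - a i else a i) = x - a j"
    "(\<Sum>i\<in>insert j I. if i \<in> S - {j} then - a i else a i) = x + a j"
    using insert.hyps by simp_all
  moreover have "\<bar>x - a j\<bar> \<le> M \<or> \<bar>x + a j\<bar> \<le> M"
    using S aj unfolding x_def[symmetric] by arith
  ultimately show ?case
    by metis
qed simp

text \<open>Rotating the negative terms of a short signed sum of \<open>a 2, \<dots>, a r\<close> continuously back to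
  positive ones, the modulus of the sum takes the value \<open>a 1\<close> on the way.\<close>

lemma polygon_closes:
  fixes a :: "nat \<Rightarrow> real"
  assumes nonneg: "\<And>i. i \<in> {1..r} \<Longrightarrow> 0 \<le> a i" and max: "\<And>i. i \<in> {1..r} \<Longrightarrow> a i \<le> a 1"
    and "1 \<le> r" and le: "a 1 \<le> (\<Sum>i=2..r. a i)"
  obtains u :: "nat \<Rightarrow> complex" where "\<And>i. cmod (u i) = 1" "(\<Sum>i=1..r. complex_of_real (a i) * u i) = 0"
proof -
  have "0 \<le> a 1"
    using nonneg \<open>1 \<le> r\<close> by simp
  then obtain S where S: "\<bar>\<Sum>i=2..r. if i \<in> S then - a i else a i\<bar> \<le> a 1"
    using exists_small_signed_sum[of "{2..r}" a "a 1"] nonneg max by auto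
  define v where "v t i = (if i \<in> S then cis (pi * t) else 1)" for t :: real and i
  define g where "g t = (\<Sum>i=2..r. complex_of_real (a i) * v t i)" for t
  have "continuous_on {0..1} (\<lambda>t. v t i)" for i
    by (cases "i \<in> S") (auto simp: v_def intro!: continuous_intros)
  then have "continuous_on {0..1} (\<lambda>t. cmod (g t))"
    unfolding g_def by (intro continuous_intros)
  moreover have "a 1 \<le> cmod (g 0)"
  proof -
    have "g 0 = complex_of_real (\<Sum>i=2..r. a i)"
      unfolding g_def of_real_sum by (intro sum.cong refl) (simp add: v_def)
    then have "cmod (g 0) = \<bar>\<Sum>i=2..r. a i\<bar>"
      by (simp only: norm_of_real)
    then show ?thesis
      using le by simp
  qed
  moreover have "cmod (g 1) \<le> a 1"
  proof -
    have "g 1 = complex_of_real (\<Sum>i=2..r. if i \<in> S then - a i else a i)"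
      unfolding g_def of_real_sum by (intro sum.cong refl) (simp add: v_def)
    then show ?thesis
      using S by (simp only: norm_of_real)
  qed
  ultimately obtain t where t: "cmod (g t) = a 1"
    using IVT2'[of "\<lambda>t. cmod (g t)" 1 "a 1" 0] by auto
  \<comment> \<open>\<open>w\<close> is the direction of \<open>g t\<close>. If
    \<open>g t = 0\<close>, then \<open>a 1 = 0\<close> and any unit number serves.\<close>
  define w where "w = (if g t = 0 then 1 else sgn (g t))"
  have w: "cmod w = 1"
    by (simp add: w_def norm_sgn)
  have gw: "g t = complex_of_real (a 1) * w"
    unfolding t[symmetric] by (auto simp: w_def sgn_eq)
  define u where "u i = (if i = 1 then - w else v t i)" for i
  have "cmod (u i) = 1" for i
    by (simp add: u_def v_def w)
  moreover have "(\<Sum>i=1..r. complex_of_real (a i) * u i) = 0"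
  proof -
    have "(\<Sum>i=1..r. complex_of_real (a i) * u i) = complex_of_real (a 1) * u 1 + (\<Sum>i=2..r. complex_of_real (a i) * u i)"
      using \<open>1 \<le> r\<close> by (simp add: sum.atLeast_Suc_atMost numeral_2_eq_2)
    also have "(\<Sum>i=2..r. complex_of_real (a i) * u i) = g t"
      unfolding g_def by (intro sum.cong refl) (simp add: u_def)
    finally show ?thesis
      by (simp add: u_def gw)
  qed
  ultimately show ?thesis
    using that by blast
qed

section \<open>Orthogonality of sign patterns\<close>

definition subset_sign :: "'i set \<Rightarrow> 'i \<Rightarrow> complex" where
  "subset_sign S i = (if i \<in> S then - 1 else 1)"

lemma subset_sign_simps [simp]: "subset_sign S i * subset_sign S i = 1" "cnj (subset_sign S i) = subset_sign S i"
  by (simp_all add: subset_sign_def)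

text \<open>For distinct \<open>i\<close> and \<open>j\<close>, toggling the membership of
  \<open>i\<close> is an involution of \<open>Pow I\<close> that negates the summand, so the sum
  equals its own negative.\<close>

lemma subset_sign_orthogonal:
  assumes "finite I" "i \<in> I" "j \<in> I"
  shows "(\<Sum>S\<in>Pow I. subset_sign S i * subset_sign S j) = (if i = j then 2 ^ card I else 0)"
proof (cases "i = j")
  case True
  then show ?thesis
    using assms by (simp add: card_Pow)
next
  case False
  define flip where "flip S = (if i \<in> S then S - {i} else insert i S)" for S
  have "(\<Sum>S\<in>Pow I. subset_sign S i * subset_sign S j) = (\<Sum>S\<in>Pow I. - (subset_sign S i * subset_sign S j))"
    by (rule sum.reindex_bij_witness[of _ flip flip])
      (use assms False in \<open>auto simp: flip_def subset_sign_def split: if_splits\<close>)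
  then show ?thesis
    using False by (simp add: sum_negf)
qed

section \<open>The Slater number criterion\<close>

theorem theorem1:
  fixes \<rho> :: "complex ^ (4 \<times> 4) ^ (4 \<times> 4)"
    and r :: nat
    and \<Psi> :: "nat \<Rightarrow> complex ^ (4 \<times> 4)"
    and ev :: "nat \<Rightarrow> real"
    and e :: "4 \<Rightarrow> complex ^ 4"
    and w :: "nat \<Rightarrow> complex ^ 4 ^ 4"
    and U :: "nat \<Rightarrow> nat \<Rightarrow> complex"
    and c :: "nat \<Rightarrow> complex"
  assumes state: "fermionic_density_matrix \<rho>"
    and rank: "r = rank \<rho>"
    and spectral: "\<rho> = (\<Sum>i=1..r. ketbra (\<Psi> i))"
    and eigenvalues: "\<And>i. i \<in> {1..r} \<Longrightarrow> ev i \<noteq> 0"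
    and eigenvectors: "\<And>i. i \<in> {1..r} \<Longrightarrow> \<rho> *v \<Psi> i = complex_of_real (ev i) *s \<Psi> i"
    and normalization: "\<And>i j. i \<in> {1..r} \<Longrightarrow> j \<in> {1..r} \<Longrightarrow>
          cinner (\<Psi> i) (\<Psi> j) = (if i = j then complex_of_real (ev i) else 0)"
    and basis: "orthonormal_basis e"
    and antisymmetric: "\<And>i. i \<in> {1..r} \<Longrightarrow> transpose (w i) = - w i"
    and expansion: "\<And>i. i \<in> {1..r} \<Longrightarrow>
          \<Psi> i = (\<Sum>a\<in>UNIV. \<Sum>b\<in>UNIV. w i $ a $ b *s fermion_pair (e a) (e b))"
    and unitary: "unitary_matrix r U"
    and diagonalization: "\<And>i j. i \<in> {1..r} \<Longrightarrow> j \<in> {1..r} \<Longrightarrow>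
          correlation_matrix w i j = (\<Sum>k=1..r. \<Sum>l=1..r. U i k * diag_matrix c k l * U j l)"
    and ordering: "\<And>i j. 1 \<le> i \<Longrightarrow> i \<le> j \<Longrightarrow> j \<le> r \<Longrightarrow> cmod (c i) \<ge> cmod (c j)"
  shows "slater_number \<rho> = 1 \<longleftrightarrow> cmod (c 1) \<le> (\<Sum>i=2..r. cmod (c i))"
proof -
  have antisym_sum: "(\<Sum>i\<in>I. f i *s x i) \<in> antisym_space" if "\<And>i. i \<in> I \<Longrightarrow> x i \<in> antisym_space"
    for I and f :: "nat \<Rightarrow> complex" and x :: "nat \<Rightarrow> complex ^ (4 \<times> 4)"
  proof -
    have "(\<Sum>i\<in>I. f i *s x i) $ (a, b) = - (\<Sum>i\<in>I. f i *s x i) $ (b, a)" for a b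
    proof -
      have "x i $ (a, b) = - x i $ (b, a)" if "i \<in> I" for i
        using \<open>\<And>i. i \<in> I \<Longrightarrow> x i \<in> antisym_space\<close>[OF that] unfolding antisym_space_def by blast
      then show ?thesis
        unfolding sum_component vector_smult_component sum_negf[symmetric]
        by (intro sum.cong refl) (metis mult_minus_right)
    qed
    then show ?thesis
      unfolding antisym_space_def by blast
  qed
  have "trace \<rho> = 1"
    using state by (simp add: fermionic_density_matrix_def density_matrix_def)
  have "1 \<le> r"
  proof (rule ccontr)
    assume "\<not> 1 \<le> r"
    then show False
      using spectral \<open>trace \<rho> = 1\<close> by (simp add: trace_def)
  qed
  \<comment> \<open>An eigenvector with nonzero eigenvalue lies in the range of \<rho>.\<close>
  have \<Psi>: "\<Psi> i \<in> antisym_space" if "i \<in> {1..r}" for i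
  proof -
    have "\<rho> *v \<Psi> i \<in> antisym_space"
      using state by (simp add: fermionic_density_matrix_def)
    then have "complex_of_real (ev i) * \<Psi> i $ (a, b) = - (complex_of_real (ev i) * \<Psi> i $ (b, a))" for a b
      unfolding eigenvectors[OF that] antisym_space_def mem_Collect_eq vector_smult_component by blast
    then have "\<Psi> i $ (a, b) = - \<Psi> i $ (b, a)" for a b
      using eigenvalues[OF that] by (metis mult_cancel_left mult_minus_right of_real_eq_0_iff)
    then show ?thesis
      unfolding antisym_space_def by blast
  qed
  define \<kappa> where "\<kappa> = 2 * det (\<chi> a. e a)"
  have "\<kappa> \<noteq> 0"
    using orthonormal_basis_det_nz[OF basis] by (simp add: \<kappa>_def)
  have pf\<Psi>: "pfaffian_form (\<Psi> i) (\<Psi> j) = \<kappa> * (\<Sum>l=1..r. c l * (U i l * U j l))"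
    if "i \<in> {1..r}" "j \<in> {1..r}" for i j
  proof -
    have "pfaffian_form (\<Psi> i) (\<Psi> j) = \<kappa> * correlation_matrix w i j"
      unfolding \<kappa>_def by (rule pfaffian_form_expansion[OF expansion[OF that(1)] expansion[OF that(2)]])
    also have "correlation_matrix w i j = (\<Sum>k=1..r. \<Sum>l=1..r. if l = k then c l * (U i l * U j l) else 0)"
      unfolding diagonalization[OF that] by (intro sum.cong refl) (simp add: diag_matrix_def)
    also have "\<dots> = (\<Sum>l=1..r. c l * (U i l * U j l))"
      by (intro sum.cong refl) simp
    finally show ?thesis .
  qed
  \<comment> \<open>In the coordinates obtained from \<open>x\<close> through \<open>U\<close>, the
    form is diagonal with entries \<open>c l\<close>, up to the nonzero factor \<kappa>.\<close>
  have pf_sum: "pfaffian_form (\<Sum>i=1..r. x i *s \<Psi> i) (\<Sum>i=1..r. x i *s \<Psi> i) =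
      \<kappa> * (\<Sum>l=1..r. c l * (\<Sum>i=1..r. x i * U i l)\<^sup>2)" for x
  proof -
    have "pfaffian_form (\<Sum>i=1..r. x i *s \<Psi> i) (\<Sum>i=1..r. x i *s \<Psi> i) =
        (\<Sum>i=1..r. \<Sum>j=1..r. \<Sum>l=1..r. \<kappa> * (c l * (x i * U i l * (x j * U j l))))"
      unfolding pfaffian_form_sums by (intro sum.cong refl) (simp add: pf\<Psi> sum_distrib_left mult_ac)
    also have "\<dots> = (\<Sum>i=1..r. \<Sum>l=1..r. \<Sum>j=1..r. \<kappa> * (c l * (x i * U i l * (x j * U j l))))"
      by (intro sum.cong refl sum.swap)
    also have "\<dots> = (\<Sum>l=1..r. \<Sum>i=1..r. \<Sum>j=1..r. \<kappa> * (c l * (x i * U i l * (x j * U j l))))"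
      by (rule sum.swap)
    also have "\<dots> = \<kappa> * (\<Sum>l=1..r. c l * (\<Sum>i=1..r. x i * U i l)\<^sup>2)"
      unfolding power2_eq_square sum_product by (simp only: sum_distrib_left)
    finally show ?thesis .
  qed
  obtain N0 p0 \<psi>0 where "pure_decomposition \<rho> N0 p0 \<psi>0"
    using pure_decomposition_of_ensemble[OF _ spectral \<open>trace \<rho> = 1\<close> \<Psi>] by blast
  note slater = slater_number_eq_1_iff[OF this]
  show ?thesis
  proof

    \<comment> \<open>Necessity of the polygon inequality\<close>
    assume "slater_number \<rho> = 1"
    then obtain N p \<psi> where d: "pure_decomposition \<rho> N p \<psi>" and pf: "\<And>k. k \<in> {1..N} \<Longrightarrow> pfaffian_form (\<psi> k) (\<psi> k) = 0"
      unfolding slater by blast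
    define \<phi> where "\<phi> k = complex_of_real (sqrt (p k)) *s \<psi> k" for k
    have "p k *\<^sub>R ketbra (\<psi> k) = ketbra (\<phi> k)" if "k \<in> {1..N}" for k
    proof -
      have "0 < p k"
        using d that by (simp add: pure_decomposition_def)
      then have "complex_of_real (p k) = complex_of_real (sqrt (p k)) * complex_of_real (sqrt (p k))"
        by (simp flip: of_real_mult)
      then show ?thesis
        by (simp add: ketbra_def \<phi>_def vec_eq_iff scaleR_conv_of_real[where 'a = complex] mult_ac)
    qed
    then have "(\<Sum>k=1..N. ketbra (\<phi> k)) = (\<Sum>i=1..r. ketbra (\<Psi> i))"
      using d spectral by (simp add: pure_decomposition_def)
    then obtain T where T: "\<And>k. k \<in> {1..N} \<Longrightarrow> \<phi> k = (\<Sum>i=1..r. T k i *s \<Psi> i)"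
      and iso: "\<And>i j. i \<in> {1..r} \<Longrightarrow> j \<in> {1..r} \<Longrightarrow> (\<Sum>k=1..N. T k i * cnj (T k j)) = (if i = j then 1 else 0)"
      using ensembles_isometric[of "{1..r}" \<phi> "{1..N}" \<Psi> ev] normalization eigenvalues by auto
    \<comment> \<open>The product of the isometry \<open>T\<close> with the unitary \<open>U\<close>
      has normalized columns.\<close>
    define V where "V k l = (\<Sum>i=1..r. T k i * U i l)" for k l
    show "cmod (c 1) \<le> (\<Sum>i=2..r. cmod (c i))"
    proof (rule polygon_inequality_of_isotropic_vectors[OF \<open>1 \<le> r\<close>])
      show "(\<Sum>l=1..r. c l * (V k l)\<^sup>2) = 0" if "k \<in> {1..N}" for k
      proof -
        have "pfaffian_form (\<phi> k) (\<phi> k) = 0"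
          by (simp add: \<phi>_def pfaffian_form_simps pf[OF that])
        then show ?thesis
          unfolding T[OF that] pf_sum V_def using \<open>\<kappa> \<noteq> 0\<close> by simp
      qed
      show "(\<Sum>k=1..N. (cmod (V k l))\<^sup>2) = 1" if "l \<in> {1..r}" for l
      proof -
        have "complex_of_real (\<Sum>k=1..N. (cmod (V k l))\<^sup>2) = (\<Sum>k=1..N. V k l * cnj (V k l))"
          by (simp only: of_real_sum complex_norm_square)
        also have "\<dots> = (\<Sum>k=1..N. \<Sum>i=1..r. \<Sum>j=1..r. U i l * cnj (U j l) * (T k i * cnj (T k j)))"
          unfolding V_def cnj_sum sum_product by (intro sum.cong refl) (simp add: mult_ac)
        also have "\<dots> = (\<Sum>i=1..r. \<Sum>k=1..N. \<Sum>j=1..r. U i l * cnj (U j l) * (T k i * cnj (T k j)))"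
          by (rule sum.swap)
        also have "\<dots> = (\<Sum>i=1..r. \<Sum>j=1..r. \<Sum>k=1..N. U i l * cnj (U j l) * (T k i * cnj (T k j)))"
          by (intro sum.cong refl sum.swap)
        also have "\<dots> = (\<Sum>i=1..r. \<Sum>j=1..r. U i l * cnj (U j l) * (if i = j then 1 else 0))"
          unfolding sum_distrib_left[symmetric] by (intro sum.cong refl) (simp only: iso)
        also have "\<dots> = (\<Sum>i=1..r. cnj (U i l) * U i l)"
          by (intro sum.cong refl) (simp add: if_distrib[of "(*) _"] cong: if_cong)
        also have "\<dots> = complex_of_real 1"
          using unitary_matrix_columns[OF unitary that that] by simp
        finally show ?thesis
          unfolding of_real_eq_iff .
      qed
    qed
  next

    \<comment> \<open>Sufficiency of the polygon inequality\<close>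
    assume le: "cmod (c 1) \<le> (\<Sum>i=2..r. cmod (c i))"
    obtain u where u: "\<And>i. cmod (u i) = 1" "(\<Sum>i=1..r. complex_of_real (cmod (c i)) * u i) = 0"
      using polygon_closes[of r "\<lambda>i. cmod (c i)"] ordering \<open>1 \<le> r\<close> le by auto
    \<comment> \<open>The square root absorbs the phase of \<open>c i\<close>. The value 1 is a
      convention for \<open>c i = 0\<close>, where \<open>sgn\<close> would yield no phase.\<close>
    define \<omega> where "\<omega> i = (if c i = 0 then 1 else csqrt (u i / sgn (c i)))" for i
    have \<omega>2: "c i * (\<omega> i)\<^sup>2 = complex_of_real (cmod (c i)) * u i" for i
      by (simp add: \<omega>_def sgn_eq)
    have "cmod (\<omega> i) = 1" for i
    proof -
      have "(cmod (\<omega> i))\<^sup>2 = 1"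
        by (simp add: \<omega>_def norm_power[symmetric] norm_divide u norm_sgn)
      then show ?thesis
        using norm_ge_zero[of "\<omega> i"] unfolding power2_eq_1_iff by linarith
    qed
    then have \<omega>: "\<omega> i * cnj (\<omega> i) = 1" for i
      by (simp add: complex_norm_square[symmetric])
    \<comment> \<open>There are \<open>2 ^ r\<close> sign patterns, and \<open>s\<close> normalizes
      the columns of \<open>A\<close>.\<close>
    define s where "s = complex_of_real (1 / sqrt (2 ^ r))"
    have s: "s * cnj s = 1 / 2 ^ r"
      by (simp add: s_def flip: of_real_mult)
    define A where "A S l = s * (subset_sign S l * \<omega> l)" for S l
    \<comment> \<open>\<open>A\<close> holds the coefficients in the rotated ensemble,
      \<open>B\<close> those in the original \<Psi>; multiplying \<open>B\<close> by
      \<open>U\<close> recovers \<open>A\<close>.\<close>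
    define B where "B S i = (\<Sum>l=1..r. A S l * cnj (U i l))" for S i
    define \<phi> where "\<phi> S = (\<Sum>i=1..r. B S i *s \<Psi> i)" for S
    have \<phi>: "\<phi> S = (\<Sum>l=1..r. A S l *s (\<Sum>i=1..r. cnj (U i l) *s \<Psi> i))" for S
    proof -
      have "\<phi> S $ ab = (\<Sum>i=1..r. \<Sum>l=1..r. A S l * (cnj (U i l) * \<Psi> i $ ab))" for ab
        by (simp add: \<phi>_def B_def sum_distrib_right mult.assoc)
      also have "\<dots> ab = (\<Sum>l=1..r. \<Sum>i=1..r. A S l * (cnj (U i l) * \<Psi> i $ ab))" for ab
        by (rule sum.swap)
      finally show ?thesis
        by (simp add: vec_eq_iff sum_distrib_left)
    qed
    have "(\<Sum>S\<in>Pow {1..r}. ketbra (\<phi> S)) = (\<Sum>l=1..r. ketbra (\<Sum>i=1..r. cnj (U i l) *s \<Psi> i))"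
      unfolding \<phi>
    proof (rule ketbra_isometric_mixture)
      fix l m assume lm: "l \<in> {1..r}" "m \<in> {1..r}"
      have "(\<Sum>S\<in>Pow {1..r}. A S l * cnj (A S m)) =
          s * cnj s * (\<omega> l * cnj (\<omega> m)) * (\<Sum>S\<in>Pow {1..r}. subset_sign S l * subset_sign S m)"
        unfolding sum_distrib_left by (intro sum.cong refl) (simp add: A_def mult_ac)
      also have "\<dots> = (if l = m then 1 else 0)"
        using subset_sign_orthogonal[OF finite_atLeastAtMost lm] by (simp add: s \<omega>)
      finally show "(\<Sum>S\<in>Pow {1..r}. A S l * cnj (A S m)) = (if l = m then 1 else 0)" .
    qed simp
    also have "\<dots> = (\<Sum>i=1..r. ketbra (\<Psi> i))"
    proof (rule ketbra_isometric_mixture)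
      fix i j assume "i \<in> {1..r}" "j \<in> {1..r}"
      then show "(\<Sum>l=1..r. cnj (U i l) * cnj (cnj (U j l))) = (if i = j then 1 else 0)"
        using unitary by (auto simp: unitary_matrix_def mult.commute)
    qed simp
    finally have \<rho>: "\<rho> = (\<Sum>S\<in>Pow {1..r}. ketbra (\<phi> S))"
      using spectral by simp
    have BU: "(\<Sum>i=1..r. B S i * U i m) = A S m" if "m \<in> {1..r}" for S m
    proof -
      have "(\<Sum>i=1..r. B S i * U i m) = (\<Sum>i=1..r. \<Sum>l=1..r. A S l * (cnj (U i l) * U i m))"
        by (simp add: B_def sum_distrib_right mult.assoc)
      also have "\<dots> = (\<Sum>l=1..r. \<Sum>i=1..r. A S l * (cnj (U i l) * U i m))"
        by (rule sum.swap)
      also have "\<dots> = (\<Sum>l=1..r. A S l * (if l = m then 1 else 0))"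
        unfolding sum_distrib_left[symmetric] using that
        by (intro sum.cong refl) (simp only: unitary_matrix_columns[OF unitary])
      finally show ?thesis
        using that by (simp add: if_distrib[of "(*) _"] cong: if_cong)
    qed
    have pf\<phi>: "pfaffian_form (\<phi> S) (\<phi> S) = 0" for S
    proof -
      \<comment> \<open>Squaring removes the signs, so every sign pattern yields the same closed
        polygon.\<close>
      have "(\<Sum>l=1..r. c l * (\<Sum>i=1..r. B S i * U i l)\<^sup>2) = (\<Sum>l=1..r. s\<^sup>2 * (c l * (\<omega> l)\<^sup>2))"
        by (intro sum.cong refl)
          (simp only: BU, simp add: A_def power_mult_distrib power2_eq_square[of "subset_sign _ _"])
      also have "\<dots> = 0"
        unfolding sum_distrib_left[symmetric] \<omega>2 by (simp only: u(2) mult_zero_right)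
      finally show ?thesis
        unfolding \<phi>_def pf_sum by (simp only: mult_zero_right)
    qed
    have antisym: "\<phi> S \<in> antisym_space" for S
      unfolding \<phi>_def by (rule antisym_sum) (rule \<Psi>)
    have "finite (Pow {1..r})"
      by simp
    then obtain N p \<psi> where "pure_decomposition \<rho> N p \<psi>"
      and \<psi>: "\<And>i. i \<in> {1..N} \<Longrightarrow> \<exists>S\<in>Pow {1..r}. \<exists>t. \<psi> i = t *s \<phi> S"
      using pure_decomposition_of_ensemble[OF _ \<rho> \<open>trace \<rho> = 1\<close> antisym] by blast
    moreover have "pfaffian_form (\<psi> i) (\<psi> i) = 0" if "i \<in> {1..N}" for i
      using \<psi>[OF that] by (auto simp: pfaffian_form_simps pf\<phi>)
    ultimately show "slater_number \<rho> = 1"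
      unfolding slater by blast
  qed
qed

end
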